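(* Let $p>5$ be a prime with $p\equiv 5\pmod 6$. Then every $a\in\mathcal A_p$ and $c\in\mathbb F_p$ give an APN permutation $\mathcal B_{a,c,p}$ of $\mathbb Z_{2p}$. For each such order $2p$, there are exactly $p|\mathcal A_p|=p(p+1+T_p)/8$ distinct APN permutations within the parametrized family $\{\mathcal B_{a,c,p}: a\in\mathbb F_p^*,\ c\in\mathbb F_p\}$, and this number is at least $p(p+1-2\sqrt p)/8$.
   Context: $\mathbb Z_n=\mathbb Z/n\mathbb Z$. The differential uniformity of $F:\mathbb Z_n\to\mathbb Z_n$ is $\delta(F)=\max_{u\neq 0,\,v\in\mathbb Z_n}\#\{x\in\mathbb Z_n: F(x+u)-F(x)=v\}$, and $F$ is called APN if $\delta(F)=2$. Let $p\ge 11$ be a prime, $a\in\mathbb F_p^*$, $c\in\mathbb F_p$. $\chi$ is the quadratic character of $\mathbb F_p$ (with $\chi(0)=0$), and $\rho(x)=1$ if $\chi(x)=1$, $\rho(x)=0$ otherwise (so $\rho(0)=0$). For $z\in\mathbb Z_{2p}$ let $E(z)=(1-(-1)^z)/2\in\{0,1\}$ (the parity of $z$) and let $X_c(z)\in\mathbb F_p$ be the residue class of $z+cE(z)$ modulo $p$. In $\mathbb F_p$ set $A_a(z)=1+(a-1)E(z)$ and $Y_{a,c,p}(z)=A_a(z)X_c(z)^{p-2}$. Let $R_{c,p}(z)\in\{0,1\}$ be congruent modulo $2$ to $\rho(X_c(z))+E(z)\bigl(1-\chi(X_c(z))^2\bigr)$. Define $\mathcal B_{a,c,p}:\mathbb Z_{2p}\to\mathbb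 Z_{2p}$ by $$\mathcal B_{a,c,p}(z)\equiv pR_{c,p}(z)+(p+1)Y_{a,c,p}(z)\pmod{2p},$$ where $Y_{a,c,p}(z)$ is replaced by any integer representative (the result is independent of the choice since $2p\mid p(p+1)$). Further, $\mathcal A_p=\{a\in\mathbb F_p^*:\chi(a)=\chi(1-4a)=\chi(1-4/a)=-1\}$ and $T_p=\sum_{z\in\mathbb F_p}\chi(z(z-4)(1-4z))$. *)

theory Defs
  imports
    Complex_Main
    "HOL-Library.FuncSet"
    "HOL-Number_Theory.Number_Theory"
    "HOL-Number_Theory.Modular_Inverse"
begin

text \<open>
  Elements of the ring of integers modulo \<open>n\<close>, and in particular of the prime field with \<open>p\<close>
  elements, are represented by their least nonnegative residues of type \<^typ>\<open>int\<close>.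
\<close>

definition Zn :: "nat \<Rightarrow> int set" where
  "Zn n = {0..<int n}"

definition units_mod :: "nat \<Rightarrow> int set" where
  "units_mod n = {a \<in> Zn n. coprime a (int n)}"

definition diff_uniformity :: "nat \<Rightarrow> (int \<Rightarrow> int) \<Rightarrow> nat" where
  "diff_uniformity n F =
     Max {card {x \<in> Zn n. (F ((x + u) mod int n) - F x) mod int n = v} | u v.
            u \<in> Zn n \<and> u \<noteq> 0 \<and> v \<in> Zn n}"

definition APN :: "nat \<Rightarrow> (int \<Rightarrow> int) \<Rightarrow> bool" where
  "APN n F \<longleftrightarrow> F \<in> Zn n \<rightarrow> Zn n \<and> diff_uniformity n F = 2"

definition APN_permutation :: "nat \<Rightarrow> (int \<Rightarrow> int) \<Rightarrow> bool" where
  "APN_permutation n F \<longleftrightarrow> APN n F \<and> bij_betw F (Zn n) (Zn n)"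

definition rho :: "nat \<Rightarrow> int \<Rightarrow> int" where
  "rho p x = (if Legendre x (int p) = 1 then 1 else 0)"

definition parity :: "int \<Rightarrow> int" where
  "parity z = z mod 2"

definition X_res :: "nat \<Rightarrow> int \<Rightarrow> int \<Rightarrow> int" where
  "X_res p c z = (z + c * parity z) mod int p"

definition A_coeff :: "nat \<Rightarrow> int \<Rightarrow> int \<Rightarrow> int" where
  "A_coeff p a z = (1 + (a - 1) * parity z) mod int p"

definition Y_res :: "nat \<Rightarrow> int \<Rightarrow> int \<Rightarrow> int \<Rightarrow> int" where
  "Y_res p a c z = (A_coeff p a z * X_res p c z ^ (p - 2)) mod int p"

definition R_bit :: "nat \<Rightarrow> int \<Rightarrow> int \<Rightarrow> int" where
  "R_bit p c z =
     (rho p (X_res p c z) + parity z * (1 - (Legendre (X_res p c z) (int p))\<^sup>2)) mod 2"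

text \<open>
  The map is made extensional (undefined outside \<open>Zn (2 * p)\<close>), so that HOL equality of two
  such maps is equality as functions on the integers modulo \<open>2 * p\<close>.
\<close>

definition B_map :: "nat \<Rightarrow> int \<Rightarrow> int \<Rightarrow> int \<Rightarrow> int" where
  "B_map p a c =
     (\<lambda>z \<in> Zn (2 * p). (int p * R_bit p c z + (int p + 1) * Y_res p a c z) mod int (2 * p))"

definition A_set :: "nat \<Rightarrow> int set" where
  "A_set p = {a \<in> units_mod p.
     Legendre a (int p) = -1 \<and>
     Legendre (1 - 4 * a) (int p) = -1 \<and>
     Legendre (1 - 4 * modular_inverse (int p) a) (int p) = -1}"

definition T_sum :: "nat \<Rightarrow> int" where
  "T_sum p = (\<Sum>z \<in> Zn p. Legendre (z * (z - 4) * (1 - 4 * z)) (int p))"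

definition B_family :: "nat \<Rightarrow> (int \<Rightarrow> int) set" where
  "B_family p = {B_map p a c | a c. a \<in> units_mod p \<and> c \<in> Zn p}"

end

theory Submission
  imports
    Defs
    "Berlekamp_Zassenhaus.Finite_Field"
    "HOL-Computational_Algebra.Polynomial_Factorial"
begin

text \<open>
  Write \<open>e\<close> for the parity of \<open>z\<close> and \<open>x\<close> for its residue modulo \<open>p\<close>. The Chinese remainder
  theorem turns \<open>B_map p a c\<close> into the map
  \<open>(e, x) \<mapsto> (rho(y) + e * [y = 0], (if e then a else 1) / y)\<close> with \<open>y = x + c e\<close>,
  from \<open>bool\<close> times the field to itself (lemma \<open>residue_pair_B_map\<close>). It is injective exactly
  when \<open>a\<close> is a nonresidue: \<open>(0, x)\<close> and \<open>(1, a x - c)\<close> share their second component, and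
  for \<open>x \<noteq> 0\<close> their first components differ iff \<open>x\<close> and \<open>a x\<close> have different characters.

  Each derivative equation \<open>F (z + u) - F z = (h, w)\<close> is a quadratic equation on each of the two
  parity classes of \<open>z\<close>; the bit \<open>h\<close> prescribes the character of the product of the two arguments
  that get inverted. If \<open>u\<close> is even, the products on the two classes differ by the factor \<open>a\<close>, so
  only one class contributes its at most two roots. If \<open>u\<close> is odd, the two roots of a class
  give two such products whose product is \<open>a\<close> times a square; their characters differ, so each
  class contributes at most one root. The argument 0, where the inverse is 0 by convention, is
  exceptional; the exceptional solutions compete with generic ones exactly when one of
  \<open>x\<^sup>2 + x + 1\<close>, \<open>x\<^sup>2 + x + a\<close>, \<open>x\<^sup>2 + x + 1/a\<close> has a root. The first one is excluded by
  \<open>p mod 3 = 2\<close>, the other two by the conditions on \<open>1 - 4 a\<close> and \<open>1 - 4 / a\<close>. Conversely a root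
  of one of the latter gives three solutions of a suitable equation. Hence the APN permutations
  of the family are those with \<open>a\<close> in \<open>A_set p\<close>
  (lemmas \<open>solutions_card_le_2\<close>, \<open>solutions_ge_2\<close>, \<open>admissible_if_APN\<close>), and \<open>a\<close> and \<open>c\<close> can be read
  off from the map (lemma \<open>field_map_parameters_unique\<close>).

  The size of \<open>A_set p\<close> follows by expanding the product of the three factors
  \<open>1 - chi\<close> into character sums. All of them are elementary except the sum \<open>T_sum p\<close>, which is
  minus the trace of Frobenius of an elliptic curve (lemma \<open>card_admissible\<close>).

  The lower bound is therefore Hasse's theorem for that curve, which is proved here by Manin's
  method. For \<open>F = x\<^sup>3 + a x\<^sup>2 + b x + c\<close>, the curve \<open>F(t) y\<^sup>2 = F(x)\<close> over the rational function
  field in \<open>t\<close> carries the points \<open>Q = (t, 1)\<close> and \<open>P = (t\<^sup>p, F(t) ^ ((p - 1) / 2))\<close>. The degrees of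
  the abscissas of the points \<open>P + n Q\<close> have constant second difference 2, hence are a
  quadratic polynomial \<open>n\<^sup>2 - S n + p\<close> in \<open>n\<close>, where \<open>S\<close> is up to sign the character sum. A degree is never
  negative, so the discriminant \<open>S\<^sup>2 - 4 p\<close> is not positive. The group law enters only through
  abscissas: those of \<open>P'\<close> and \<open>P' + Q\<close> or \<open>P' - Q\<close> are tied by a symmetric biquadratic form, and
  of the two roots of a quadratic one determines the other.

  Finite fields enter as types, whereas the theorem quantifies over the prime \<open>p\<close>. It suffices to
  have one type, whose cardinality is a prime chosen such that the theorem for this prime
  implies the theorem for all primes (lemma \<open>decisive_prime\<close>).
\<close>

section \<open>Heights of translates on a twisted elliptic curve\<close>

text \<open>
Let \<open>F = x\<^sup>3 + a x\<^sup>2 + b x + c\<close>. On the curve \<open>F(t) y\<^sup>2 = F(x)\<close> let \<open>Q = (t, 1)\<close> and let \<open>P\<close> have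
the abscissa \<open>f / g\<close>. By the addition formula, the abscissas of \<open>P + Q\<close> and \<open>P - Q\<close> have the sum
\<open>mid / lead\<close> and the product \<open>last / lead\<close>, where the following three forms clear the
denominators. They also make sense for \<open>g = 0\<close>, that is, for the point at infinity.
\<close>

definition lead_form :: "'a::comm_ring_1 \<Rightarrow> 'a \<Rightarrow> 'a \<Rightarrow> 'a" where
  "lead_form t f g = (f - t * g)\<^sup>2"

definition mid_form :: "'a::comm_ring_1 \<Rightarrow> 'a \<Rightarrow> 'a \<Rightarrow> 'a \<Rightarrow> 'a \<Rightarrow> 'a \<Rightarrow> 'a" where
  "mid_form a b c t f g =
     2 * (f * t * (f + t * g) + 2 * a * t * f * g + b * g * (f + t * g) + 2 * c * g\<^sup>2)"

definition last_form :: "'a::comm_ring_1 \<Rightarrow> 'a \<Rightarrow> 'a \<Rightarrow> 'a \<Rightarrow> 'a \<Rightarrow> 'a \<Rightarrow> 'a" where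
  "last_form a b c t f g = (f * t - b * g)\<^sup>2 - 4 * c * g * (f + t * g + a * g)"

text \<open>
Projective abscissas \<open>(f : g)\<close> and \<open>(r : s)\<close> of two points whose sum or difference is \<open>Q\<close> or \<open>-Q\<close>.
All that the argument uses of the group law is contained in this relation between abscissas.
\<close>

definition translates :: "'a::comm_ring_1 \<Rightarrow> 'a \<Rightarrow> 'a \<Rightarrow> 'a \<Rightarrow> 'a \<times> 'a \<Rightarrow> 'a \<times> 'a \<Rightarrow> bool" where
  "translates a b c t = (\<lambda>(f, g) (r, s).
     lead_form t f g * r\<^sup>2 - mid_form a b c t f g * r * s + last_form a b c t f g * s\<^sup>2 = 0)"

lemma translates_sym:
  "translates a b c t v w \<Longrightarrow> translates a b c t w v"
proof -
  obtain f g r s where v: "v = (f, g)" "w = (r, s)" by (cases v, cases w)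
  have "lead_form t f g * r\<^sup>2 - mid_form a b c t f g * r * s + last_form a b c t f g * s\<^sup>2
      = lead_form t r s * f\<^sup>2 - mid_form a b c t r s * f * g + last_form a b c t r s * g\<^sup>2"
    unfolding lead_form_def mid_form_def last_form_def power2_eq_square by (simp add: algebra_simps)
  thus "translates a b c t v w \<Longrightarrow> translates a b c t w v"
    by (simp add: translates_def v)
qed

definition cubic :: "'a::comm_ring_1 \<Rightarrow> 'a \<Rightarrow> 'a \<Rightarrow> 'a \<Rightarrow> 'a" where
  "cubic a b c t = t ^ 3 + a * t\<^sup>2 + b * t + c"

definition cubic_deriv :: "'a::comm_ring_1 \<Rightarrow> 'a \<Rightarrow> 'a \<Rightarrow> 'a" where
  "cubic_deriv a b t = 3 * t\<^sup>2 + 2 * a * t + b"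

text \<open>
Modulo \<open>h = f - t g\<close> the point \<open>P\<close> has the same abscissa as \<open>Q\<close>, and the forms reduce to
denominator and numerator of the abscissa of \<open>2 Q\<close>.
\<close>

lemma forms_at_base_point:
  "mid_form a b c t (t * g + h) g =
     4 * g\<^sup>2 * cubic a b c t + h * (2 * (3 * t\<^sup>2 * g + t * h + 2 * a * t * g + b * g))"
  "last_form a b c t (t * g + h) g =
     g\<^sup>2 * (cubic_deriv a b t)\<^sup>2 - 4 * g\<^sup>2 * (2 * t + a) * cubic a b c t
       + h * (2 * t * g * (t\<^sup>2 - b) + t\<^sup>2 * h - 4 * c * g)"
  unfolding mid_form_def last_form_def cubic_def cubic_deriv_def
  by (simp_all add: algebra_simps power2_eq_square power3_eq_cube)

text \<open>
A prime \<open>q\<close> dividing all three forms divides \<open>f - t g\<close>, so that the forms are those at the base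
point modulo \<open>q\<close>. Then \<open>q\<close> divides both the cubic and its derivative, contrary to smoothness.
\<close>

lemma prime_not_dvd_all_forms:
  fixes f g :: "'a::field_gcd poly"
  assumes "prime q" and cop: "coprime f g" and smooth: "coprime (cubic a b c t) (cubic_deriv a b t)"
    and two: "(2::'a) \<noteq> 0"
    and lead: "q dvd lead_form t f g" and mid: "q dvd mid_form a b c t f g"
    and last: "q dvd last_form a b c t f g"
  shows False
proof -
  have pq: "prime_elem q" using \<open>prime q\<close> by auto
  hence nu: "\<not> is_unit q" by (rule prime_elem_not_unit)
  have dvd_sq: "q dvd x" if "q dvd x\<^sup>2" for x using pq that prime_elem_dvd_power by blast
  define h where "h = f - t * g"
  have f: "f = t * g + h" by (simp add: h_def)
  have h: "q dvd h" using dvd_sq[of h] lead unfolding lead_form_def h_def by simp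
  have ng: "\<not> q dvd g"
  proof
    assume "q dvd g"
    moreover from this have "q dvd f" using h f by simp
    ultimately show False using cop nu coprime_common_divisor by blast
  qed
  have four: "is_unit (4::'a poly)"
  proof -
    have "(2::'a) * 2 \<noteq> 0" using two by (metis mult_eq_0_iff)
    hence "(4::'a) \<noteq> 0" by simp
    thus ?thesis by (simp add: numeral_poly is_unit_const_poly_iff dvd_field_iff)
  qed
  have "q dvd 4 * g\<^sup>2 * cubic a b c t"
    using mid h unfolding f forms_at_base_point by (simp add: dvd_add_left_iff)
  hence "q dvd g\<^sup>2 * cubic a b c t" using four by (simp add: mult.assoc dvd_mult_unit_iff')
  hence C: "q dvd cubic a b c t" using pq ng dvd_sq by (meson prime_elem_dvd_mult_iff)
  have "q dvd g\<^sup>2 * (cubic_deriv a b t)\<^sup>2 - 4 * g\<^sup>2 * (2 * t + a) * cubic a b c t"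
    using last h unfolding f forms_at_base_point by (simp add: dvd_add_left_iff)
  hence "q dvd g\<^sup>2 * (cubic_deriv a b t)\<^sup>2"
    using C dvd_diff_left_iff[of q "4 * g\<^sup>2 * (2 * t + a) * cubic a b c t"] by simp
  hence "q dvd cubic_deriv a b t" using pq ng dvd_sq by (meson prime_elem_dvd_mult_iff)
  with C show False using smooth nu coprime_common_divisor by blast
qed

lemma coprime_cofactors:
  fixes f g :: "'a::field_gcd poly"
  assumes cop: "coprime f g" and smooth: "coprime (cubic a b c t) (cubic_deriv a b t)"
    and two: "(2::'a) \<noteq> 0"
    and "lead_form t f g = s * g'" "mid_form a b c t f g = s * f' + r * g'"
      "last_form a b c t f g = r * f'"
  shows "coprime f' g'"
proof (rule ccontr)
  assume "\<not> coprime f' g'"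
  then obtain d where d: "\<not> is_unit d" "d dvd f'" "d dvd g'" by (elim not_coprimeE)
  have "\<exists>q. prime q \<and> q dvd d"
    using prime_divisor_exists[of d] prime_divisor_exists[of "[:0, 1:] :: 'a poly"] d(1)
    by (cases "d = 0") (auto simp: is_unit_pCons_iff)
  then obtain q where q: "prime q" "q dvd f'" "q dvd g'" using d dvd_trans by blast
  show False
    by (rule prime_not_dvd_all_forms[OF q(1) cop smooth two]) (use q assms in auto)
qed

lemma cofactors_translate:
  assumes "lead_form t f g = s * g'" "mid_form a b c t f g = s * f' + r * g'"
    "last_form a b c t f g = r * f'"
  shows "translates a b c t (f, g) (f', g')"
  unfolding translates_def assms prod.case by (simp add: algebra_simps power2_eq_square)

text \<open>
Gauss's lemma for a binary quadratic form with a known primitive root \<open>(r : s)\<close>: the cofactor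
of \<open>s X - r Y\<close> has polynomial coefficients \<open>g\<close> and \<open>-f\<close>. It yields the second root \<open>(f : g)\<close>,
the abscissa on the other side of \<open>P\<close>.
\<close>

lemma root_splits_binary_quadratic:
  fixes u v w :: "'a::field_gcd poly"
  assumes cop: "coprime r s" and root: "u * r\<^sup>2 - v * r * s + w * s\<^sup>2 = 0"
  obtains f g where "u = s * g" "v = s * f + r * g" "w = r * f"
proof -
  have "s dvd u"
  proof -
    have "u * r\<^sup>2 = s * (v * r - w * s)" using root by (simp add: algebra_simps power2_eq_square)
    hence "s dvd u * r\<^sup>2" by simp
    thus ?thesis using cop by (simp add: coprime_dvd_mult_left_iff coprime_commute)
  qed
  then obtain g where g: "u = s * g" by (elim dvdE)
  have "r dvd w"
  proof -
    have "w * s\<^sup>2 = r * (v * s - u * r)" using root by (simp add: algebra_simps power2_eq_square)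
    hence "r dvd w * s\<^sup>2" by simp
    thus ?thesis using cop by (simp add: coprime_dvd_mult_left_iff coprime_commute)
  qed
  then obtain f where f: "w = r * f" by (elim dvdE)
  have *: "r * s * (s * f + r * g - v) = 0"
    using root unfolding f g by (simp add: algebra_simps power2_eq_square)
  show ?thesis
  proof (cases "r = 0 \<or> s = 0")
    case False
    thus ?thesis using * f g that[of g f] by auto
  next
    case True
    thus ?thesis
    proof
      assume r: "r = 0"
      hence "is_unit s" using cop by simp
      then obtain k where k: "1 = s * k" by (elim dvdE)
      have "w = 0" using f r by simp
      thus ?thesis using that[of g "v * k"] g r k by (metis add.right_neutral mult.left_commute mult.right_neutral mult_zero_left)
    next
      assume s: "s = 0"
      hence "is_unit r" using cop by simp
      then obtain k where k: "1 = r * k" by (elim dvdE)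
      have "u = 0" using g s by simp
      thus ?thesis using that[of "v * k" f] f s k by (metis add.left_neutral mult.left_commute mult.right_neutral mult_zero_left)
    qed
  qed
qed

definition height :: "'a::zero poly \<times> 'a poly \<Rightarrow> nat" where
  "height v = max (degree (fst v)) (degree (snd v))"

lemma height_unique:
  fixes n :: nat
  assumes "degree u \<le> n" "degree v \<le> n" "degree w \<le> n"
    and "coeff u n \<noteq> 0 \<or> coeff v n \<noteq> 0 \<or> coeff w n \<noteq> 0"
  shows "max (degree u) (max (degree v) (degree w)) = n"
  using assms le_degree[of u n] le_degree[of v n] le_degree[of w n] by (auto simp: max_def)

lemma coeff_mult_bound:
  fixes u v :: "'a::comm_semiring_0 poly"
  assumes "degree u \<le> m" "degree v \<le> n"
  shows "coeff (u * v) (m + n) = coeff u m * coeff v n"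
proof -
  have "coeff (u * v) (m + n) = (\<Sum>i\<le>m + n. coeff u i * coeff v (m + n - i))"
    by (simp add: coeff_mult)
  also have "\<dots> = (\<Sum>i\<le>m + n. if i = m then coeff u m * coeff v n else 0)"
  proof (intro sum.cong refl)
    fix i assume "i \<in> {..m + n}"
    show "coeff u i * coeff v (m + n - i) = (if i = m then coeff u m * coeff v n else 0)"
    proof (cases i m rule: linorder_cases)
      case less
      hence "degree v < m + n - i" using assms by simp
      thus ?thesis using less by (simp add: coeff_eq_0)
    next
      case greater
      hence "degree u < i" using assms by simp
      thus ?thesis using greater by (simp add: coeff_eq_0)
    qed simp
  qed
  also have "\<dots> = coeff u m * coeff v n" by simp
  finally show ?thesis .
qed

lemma height_nonzero_coeff:
  assumes "v \<noteq> (0, 0)"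
  shows "coeff (fst v) (height v) \<noteq> 0 \<or> coeff (snd v) (height v) \<noteq> 0"
proof (cases "degree (fst v) < degree (snd v)")
  case True
  hence "height v = degree (snd v)" "snd v \<noteq> 0" by (auto simp: height_def)
  thus ?thesis by simp
next
  case False
  hence *: "height v = degree (fst v)" by (simp add: height_def)
  show ?thesis
  proof (cases "fst v = 0")
    case True
    hence "snd v \<noteq> 0" "height v = degree (snd v)" using assms * False
      by (auto simp: prod_eq_iff)
    thus ?thesis by simp
  qed (use * in simp)
qed

text \<open>
Gauss's lemma at the infinite place: the largest degree among the coefficients of a product of
two linear forms is the sum of the largest degrees of the factors.
\<close>

lemma height_cofactors:
  fixes r s f g :: "'a::idom poly"
  assumes "(r, s) \<noteq> (0, 0)" "(f, g) \<noteq> (0, 0)"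
  shows "max (degree (s * g)) (max (degree (s * f + r * g)) (degree (r * f)))
           = height (r, s) + height (f, g)"
proof (rule height_unique)
  let ?m = "height (r, s)" and ?n = "height (f, g)"
  have d: "degree r \<le> ?m" "degree s \<le> ?m" "degree f \<le> ?n" "degree g \<le> ?n"
    by (auto simp: height_def)
  show "degree (s * g) \<le> ?m + ?n" "degree (r * f) \<le> ?m + ?n"
    using degree_mult_le[of s g] degree_mult_le[of r f] d by linarith+
  show "degree (s * f + r * g) \<le> ?m + ?n"
    using degree_mult_le[of s f] degree_mult_le[of r g] d by (intro degree_add_le) linarith+
  show "coeff (s * g) (?m + ?n) \<noteq> 0 \<or> coeff (s * f + r * g) (?m + ?n) \<noteq> 0 \<or>
      coeff (r * f) (?m + ?n) \<noteq> 0"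
    using height_nonzero_coeff[OF assms(1)] height_nonzero_coeff[OF assms(2)]
    by (auto simp: coeff_mult_bound d)
qed

text \<open>
If \<open>f\<close> reaches the degree \<open>height (f, g)\<close>, the leading term comes from the square in \<open>last_form\<close>;
if \<open>g\<close> reaches it, from \<open>lead_form\<close>. No other term has larger degree.
\<close>

lemma height_forms:
  fixes f g :: "'a::idom poly"
  defines "t \<equiv> [:0, 1:]"
  assumes "(f, g) \<noteq> (0, 0)"
  shows "max (degree (lead_form t f g))
           (max (degree (mid_form [:a:] [:b:] [:c:] t f g)) (degree (last_form [:a:] [:b:] [:c:] t f g)))
         = 2 * height (f, g) + 2"
proof (rule height_unique)
  let ?n = "height (f, g)"
  define e where "e = f - t * g"
  define e' where "e' = f * t - [:b:] * g"
  define k where "k = f + t * g"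
  define k' where "k' = f + t * g + [:a:] * g"
  have d: "degree f \<le> ?n" "degree g \<le> ?n" by (auto simp: height_def)
  have t: "degree (t * u) \<le> Suc (degree u)" "coeff (t * u) (Suc i) = coeff u i" for u :: "'a poly" and i
    by (simp_all add: t_def degree_pCons_le)
  have dt: "degree (t * f) \<le> Suc ?n" "degree (t * g) \<le> Suc ?n"
    using t(1)[of f] t(1)[of g] d by linarith+
  have dc: "degree ([:x:] * u) \<le> degree u" for x :: 'a and u by (simp add: degree_smult_le)
  have dcg: "degree ([:x:] * g) \<le> Suc ?n" for x :: 'a using dc[of x g] d by linarith
  have d': "degree f \<le> Suc ?n" "degree g \<le> Suc ?n" using d by simp_all
  have e: "degree e \<le> Suc ?n" unfolding e_def by (intro degree_diff_le d' dt)
  have e': "degree e' \<le> Suc ?n" unfolding e'_def mult.commute[of f] by (intro degree_diff_le dcg dt)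
  have k: "degree k \<le> Suc ?n" unfolding k_def by (intro degree_add_le d' dt)
  have k': "degree k' \<le> Suc ?n" unfolding k'_def by (intro degree_add_le d' dt dcg)
  have g0: "coeff g (Suc ?n) = 0" "coeff f (Suc ?n) = 0" using d by (auto intro: coeff_eq_0)
  have n2: "2 * ?n + 2 = Suc ?n + Suc ?n" by simp
  have prod: "degree (u * v) \<le> 2 * ?n + 2" if "degree u \<le> Suc ?n" "degree v \<le> Suc ?n" for u v :: "'a poly"
    using degree_mult_le[of u v] that by linarith
  have lead: "lead_form t f g = e * e" by (simp add: lead_form_def e_def power2_eq_square)
  have mid: "mid_form [:a:] [:b:] [:c:] t f g =
      [:2:] * ((t * f) * k + ([:2 * a:] * (f * (t * g)) + [:b:] * (g * k) + [:2 * c:] * (g * g)))"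
    unfolding mid_form_def k_def power2_eq_square
    by (simp add: algebra_simps numeral_poly)
  have last: "last_form [:a:] [:b:] [:c:] t f g = e' * e' - ([:4 * c:] * g) * k'"
    unfolding last_form_def e'_def k'_def power2_eq_square
    by (simp add: algebra_simps numeral_poly)
  show "degree (lead_form t f g) \<le> 2 * ?n + 2" unfolding lead by (intro prod e)
  show "degree (last_form [:a:] [:b:] [:c:] t f g) \<le> 2 * ?n + 2"
    unfolding last by (intro degree_diff_le prod e' dcg k')
  show "degree (mid_form [:a:] [:b:] [:c:] t f g) \<le> 2 * ?n + 2"
    unfolding mid by (intro degree_add_le prod k d' dt order.trans[OF dc])
  have "coeff (lead_form t f g) (2 * ?n + 2) = (coeff g ?n)\<^sup>2"
    unfolding lead n2 coeff_mult_bound[OF e e] by (simp add: e_def g0 t power2_eq_square)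
  moreover have "coeff (last_form [:a:] [:b:] [:c:] t f g) (2 * ?n + 2) = (coeff f ?n)\<^sup>2"
    unfolding last n2 coeff_diff coeff_mult_bound[OF e' e'] coeff_mult_bound[OF dcg k']
    by (simp add: e'_def g0 t power2_eq_square mult.commute[of f])
  ultimately show "coeff (lead_form t f g) (2 * ?n + 2) \<noteq> 0 \<or>
      coeff (mid_form [:a:] [:b:] [:c:] t f g) (2 * ?n + 2) \<noteq> 0 \<or>
      coeff (last_form [:a:] [:b:] [:c:] t f g) (2 * ?n + 2) \<noteq> 0"
    using height_nonzero_coeff[OF assms(2)] by auto
qed

text \<open>
One step along the sequence \<open>P + n Q\<close>. The three forms are the coefficients of a product of two
linear forms, so the heights of the two neighbours of \<open>(f, g)\<close> add up to \<open>2 * height (f, g) + 2\<close>: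
the second difference of the heights is 2.
\<close>

lemma next_translate:
  fixes f g r s :: "'a::field_gcd poly"
  defines "t \<equiv> [:0, 1:]"
  assumes two: "(2::'a) \<noteq> 0"
    and smooth: "coprime (cubic [:a:] [:b:] [:c:] t) (cubic_deriv [:a:] [:b:] t)"
    and cop: "coprime f g" "coprime r s" and tr: "translates [:a:] [:b:] [:c:] t (f, g) (r, s)"
  shows "\<exists>f' g'. coprime f' g' \<and> translates [:a:] [:b:] [:c:] t (f', g') (f, g) \<and>
           height (f', g') + height (r, s) = 2 * height (f, g) + 2"
proof -
  have nz: "(f, g) \<noteq> (0, 0)" "(r, s) \<noteq> (0, 0)" using cop by auto
  from tr have "lead_form t f g * r\<^sup>2 - mid_form [:a:] [:b:] [:c:] t f g * r * s
      + last_form [:a:] [:b:] [:c:] t f g * s\<^sup>2 = 0"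
    by (simp add: translates_def)
  then obtain f' g' where fg: "lead_form t f g = s * g'"
    "mid_form [:a:] [:b:] [:c:] t f g = s * f' + r * g'"
    "last_form [:a:] [:b:] [:c:] t f g = r * f'"
    using root_splits_binary_quadratic[OF cop(2)] by metis
  have cop': "coprime f' g'" by (rule coprime_cofactors[OF cop(1) smooth two fg])
  have nz': "(f', g') \<noteq> (0, 0)" using cop' by auto
  have "translates [:a:] [:b:] [:c:] t (f, g) (f', g')" by (rule cofactors_translate[OF fg])
  moreover have "height (f', g') + height (r, s) = 2 * height (f, g) + 2"
    using height_forms[OF nz(1), of a b c] height_cofactors[OF nz(2) nz'] fg
    unfolding t_def by simp
  ultimately show ?thesis using cop' translates_sym by blast
qed

text \<open>
Iterating \<open>next_translate\<close> makes the \<open>n\<close>-th height equal to the quadratic polynomial below.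
\<close>

lemma translate_sequence_nonneg:
  fixes f g r s :: "'a::field_gcd poly" and k :: int and n :: nat
  defines "t \<equiv> [:0, 1:]"
  assumes two: "(2::'a) \<noteq> 0"
    and smooth: "coprime (cubic [:a:] [:b:] [:c:] t) (cubic_deriv [:a:] [:b:] t)"
    and start: "coprime f g" "coprime r s" "translates [:a:] [:b:] [:c:] t (f, g) (r, s)"
    and height: "int (height (f, g)) = int (height (r, s)) + 1 - k"
  shows "0 \<le> int n ^ 2 - k * int n + int (height (r, s))"
proof -
  define h where "h = (\<lambda>n. int n ^ 2 - k * int n + int (height (r, s)))"
  have "\<exists>f g r s. coprime f g \<and> coprime r s \<and> translates [:a:] [:b:] [:c:] t (f, g) (r, s) \<and>
      int (height (r, s)) = h n \<and> int (height (f, g)) = h (Suc n)"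
  proof (induction n)
    case 0
    show ?case using start height unfolding h_def
      by (intro exI[of _ f] exI[of _ g] exI[of _ r] exI[of _ s]) simp
  next
    case (Suc n)
    then obtain f g r s where *: "coprime f g" "coprime r s"
      "translates [:a:] [:b:] [:c:] t (f, g) (r, s)"
      "int (height (r, s)) = h n" "int (height (f, g)) = h (Suc n)" by blast
    obtain f' g' where **: "coprime f' g'" "translates [:a:] [:b:] [:c:] t (f', g') (f, g)"
      "height (f', g') + height (r, s) = 2 * height (f, g) + 2"
      using next_translate[OF two smooth[unfolded t_def] *(1,2) *(3)[unfolded t_def]]
      unfolding t_def by blast
    have "int (height (f', g')) = 2 * h (Suc n) + 2 - h n" using **(3) *(4,5) by linarith
    also have "\<dots> = h (Suc (Suc n))" by (simp add: h_def power2_eq_square algebra_simps)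
    finally show ?case using * ** by blast
  qed
  hence "0 \<le> h n" by (metis of_nat_0_le_iff)
  thus ?thesis by (simp add: h_def)
qed

text \<open>
The value next to the minimum, at \<open>k div 2\<close>, bounds the discriminant by 0 for even \<open>k\<close>
and by 1 for odd \<open>k\<close>. Discriminant 1 would make \<open>p\<close> a product of two consecutive numbers, thus even.
\<close>

lemma discriminant_bound:
  fixes k :: int and p :: nat
  assumes "odd p" and nonneg: "\<And>n::nat. 0 \<le> int n ^ 2 - k * int n + int p" and "0 \<le> k"
  shows "k\<^sup>2 \<le> 4 * int p"
proof -
  define j where "j = k div 2"
  have j: "0 \<le> j" using \<open>0 \<le> k\<close> by (simp add: j_def)
  have *: "0 \<le> j\<^sup>2 - k * j + int p" using nonneg[of "nat j"] j by simp
  show ?thesis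
  proof (cases "even k")
    case True
    hence "k = 2 * j" by (simp add: j_def)
    thus ?thesis using * by (simp add: power2_eq_square)
  next
    case False
    hence k: "k = 2 * j + 1" by (simp add: j_def)
    have "j * (j + 1) \<le> int p" using * by (simp add: k power2_eq_square algebra_simps)
    moreover have "j * (j + 1) \<noteq> int p"
    proof
      assume "j * (j + 1) = int p"
      moreover have "even (j * (j + 1))" by simp
      ultimately show False using \<open>odd p\<close> by simp
    qed
    ultimately show ?thesis by (simp add: k power2_eq_square algebra_simps)
  qed
qed

section \<open>The quadratic character of a prime field\<close>

lemma CHAR_mod_ring: "CHAR('p::prime_card mod_ring) = CARD('p)"
proof -
  have "CHAR('p mod_ring) dvd CARD('p)" using CHAR_dvd_CARD[where ?'a = "'p mod_ring"] by simp
  moreover have "CHAR('p mod_ring) \<noteq> 1" using CHAR_prime[where ?'a = "'p mod_ring"] by fastforce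
  ultimately show ?thesis using prime_card[where ?'a = 'p] by (auto simp: prime_nat_iff)
qed

lemma of_int_mod_ring_eq_iff:
  "of_int x = (of_int y :: 'p::prime_card mod_ring) \<longleftrightarrow> [x = y] (mod int CARD('p))"
  by (simp add: of_int_eq_iff_cong_CHAR CHAR_mod_ring)

lemma of_int_mod_ring_bij:
  "bij_betw (of_int :: int \<Rightarrow> 'p::prime_card mod_ring) {0..<int CARD('p)} UNIV"
proof -
  have "inj_on (of_int :: int \<Rightarrow> 'p mod_ring) {0..<int CARD('p)}"
    by (auto simp: inj_on_def of_int_mod_ring_eq_iff cong_def)
  moreover from this have "of_int ` {0..<int CARD('p)} = (UNIV :: 'p mod_ring set)"
    by (intro card_subset_eq) (auto simp: card_image)
  ultimately show ?thesis by (simp add: bij_betw_def)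
qed

lemma of_int_mod_ring_cases:
  obtains k where "(x :: 'p::prime_card mod_ring) = of_int k"
  using of_int_mod_ring_bij[where ?'p = 'p] unfolding bij_betw_def by (metis UNIV_I imageE)

definition chi :: "'a::field \<Rightarrow> int" where
  "chi x = (if x = 0 then 0 else if \<exists>y. x = y\<^sup>2 then 1 else -1)"

lemma chi_of_int: "chi (of_int k :: 'p::prime_card mod_ring) = Legendre k (int CARD('p))"
proof -
  have "(of_int k = (0 :: 'p mod_ring)) \<longleftrightarrow> [k = 0] (mod int CARD('p))"
    using of_int_mod_ring_eq_iff[of k 0] by simp
  moreover have "(\<exists>y. of_int k = (y :: 'p mod_ring)\<^sup>2) \<longleftrightarrow> QuadRes (int CARD('p)) k"
  proof
    assume "\<exists>y. of_int k = (y :: 'p mod_ring)\<^sup>2"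
    then obtain y :: "'p mod_ring" where y: "of_int k = y\<^sup>2" by blast
    obtain j where "y = of_int j" by (rule of_int_mod_ring_cases)
    hence "of_int k = (of_int (j\<^sup>2) :: 'p mod_ring)" using y by simp
    thus "QuadRes (int CARD('p)) k"
      unfolding of_int_mod_ring_eq_iff QuadRes_def using cong_sym by blast
  next
    assume "QuadRes (int CARD('p)) k"
    then obtain j where "[j\<^sup>2 = k] (mod int CARD('p))" by (auto simp: QuadRes_def)
    hence "of_int (j\<^sup>2) = (of_int k :: 'p mod_ring)" unfolding of_int_mod_ring_eq_iff .
    thus "\<exists>y. of_int k = (y :: 'p mod_ring)\<^sup>2" by (metis of_int_power)
  qed
  ultimately show ?thesis by (auto simp: chi_def Legendre_def)
qed

lemma chi_euler:
  assumes "2 < CARD('p::prime_card)"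
  shows "of_int (chi x) = (x :: 'p mod_ring) ^ ((CARD('p) - 1) div 2)"
proof -
  obtain k where k: "x = of_int k" by (rule of_int_mod_ring_cases)
  have "[Legendre k (int CARD('p)) = k ^ ((CARD('p) - 1) div 2)] (mod int CARD('p))"
    using euler_criterion[OF prime_card assms] .
  thus ?thesis unfolding k chi_of_int of_int_power[symmetric] of_int_mod_ring_eq_iff .
qed

lemma chi_cases: "chi x = 0 \<or> chi x = 1 \<or> chi x = -1"
  by (simp add: chi_def)

lemma chi_eq_0_iff [simp]: "chi x = 0 \<longleftrightarrow> x = 0"
  by (simp add: chi_def)

lemma chi_0 [simp]: "chi 0 = 0"
  by simp

lemma chi_square: "x \<noteq> 0 \<Longrightarrow> chi (x\<^sup>2) = 1"
  by (auto simp: chi_def)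

lemma chi_1 [simp]: "chi 1 = 1"
  using chi_square[of 1] by simp

lemma nat_mod_ring_neq_0:
  assumes "0 < k" "k < CARD('p::prime_card)"
  shows "of_nat k \<noteq> (0 :: 'p mod_ring)"
  using assms by (auto simp: of_nat_eq_0_iff_char_dvd CHAR_mod_ring dest: dvd_imp_le)

lemma of_int_sign_eq_iff:
  assumes "2 < CARD('p::prime_card)" and "i \<in> {-1, 0, 1}" "j \<in> {-1, 0, 1}"
  shows "(of_int i :: 'p mod_ring) = of_int j \<longleftrightarrow> i = j"
proof -
  have "\<bar>i - j\<bar> < int CARD('p)" using assms by auto
  thus ?thesis unfolding of_int_mod_ring_eq_iff cong_iff_dvd_diff
    using zdvd_imp_le[of "int CARD('p)" "\<bar>i - j\<bar>"] by auto
qed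

lemma chi_mult:
  assumes "2 < CARD('p::prime_card)"
  shows "chi (x * y) = chi x * chi (y :: 'p mod_ring)"
proof -
  have "of_int (chi (x * y)) = (of_int (chi x * chi y) :: 'p mod_ring)"
    by (simp add: chi_euler[OF assms] power_mult_distrib)
  moreover have "chi x * chi y \<in> {-1, 0, 1}" "chi (x * y) \<in> {-1, 0, 1}"
    using chi_cases[of x] chi_cases[of y] chi_cases[of "x * y"] by auto
  ultimately show ?thesis using of_int_sign_eq_iff[OF assms] by blast
qed

lemma prod_linear_dvd:
  fixes q :: "'a::idom poly"
  assumes "finite A" "\<And>x. x \<in> A \<Longrightarrow> poly q x = 0"
  shows "(\<Prod>x\<in>A. [:- x, 1:]) dvd q"
  using assms
proof (induction A arbitrary: q rule: finite_induct)
  case (insert x A)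
  from insert.prems[of x] obtain q' where q: "q = [:- x, 1:] * q'"
    by (auto simp: poly_eq_0_iff_dvd elim: dvdE)
  have "poly q' y = 0" if "y \<in> A" for y
  proof -
    have "y \<noteq> x" using that insert.hyps by auto
    thus ?thesis using insert.prems[of y] that by (simp add: q)
  qed
  hence "(\<Prod>y\<in>A. [:- y, 1:]) dvd q'" by (rule insert.IH)
  thus ?case using insert.hyps by (simp add: q mult_dvd_mono del: mult_pCons_left)
qed simp

lemma degree_prod_linear: "degree (\<Prod>x\<in>A. [:- x, 1 :: 'a::idom:]) = card A"
  by (subst degree_prod_eq_sum_degree) auto

lemma prod_all_linear_factors:
  "(\<Prod>x\<in>UNIV. [:- x, 1 :: 'p::prime_card mod_ring:]) = [:0, 1:] ^ CARD('p) - [:0, 1:]"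
proof (rule poly_eqI_degree_lead_coeff[where n = "CARD('p)" and A = UNIV])
  let ?X = "[:0, 1:] :: 'p mod_ring poly"
  have p: "1 < CARD('p)" using prime_card[where ?'a = 'p] prime_gt_1_nat by blast
  have degp: "degree (?X ^ CARD('p)) = CARD('p)" by (simp add: degree_power_eq)
  show "degree (\<Prod>x\<in>UNIV. [:- x, 1 :: 'p mod_ring:]) \<le> CARD('p)"
    by (simp add: degree_prod_linear)
  show "degree (?X ^ CARD('p) - ?X) \<le> CARD('p)"
    using p by (intro degree_diff_le) (auto simp: degp)
  have "coeff (\<Prod>x\<in>UNIV. [:- x, 1 :: 'p mod_ring:]) CARD('p)
      = lead_coeff (\<Prod>x\<in>UNIV. [:- x, 1 :: 'p mod_ring:])"
    by (simp add: degree_prod_linear)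
  also have "\<dots> = 1" by (simp add: lead_coeff_prod)
  also have "\<dots> = coeff (?X ^ CARD('p) - ?X) CARD('p)"
    using p lead_coeff_power[of ?X "CARD('p)"] by (simp add: degp coeff_eq_0)
  finally show "coeff (\<Prod>x\<in>UNIV. [:- x, 1 :: 'p mod_ring:]) CARD('p)
      = coeff (?X ^ CARD('p) - ?X) CARD('p)" .
  fix x :: "'p mod_ring"
  have "poly (?X ^ CARD('p) - ?X) x = x ^ CARD('p mod_ring) - x" by (simp add: poly_power)
  also have "\<dots> = 0" by (subst finite_field_power_card_eq_same) simp
  finally show "poly (\<Prod>x\<in>UNIV. [:- x, 1:]) x = poly (?X ^ CARD('p) - ?X) x"
    by (simp add: poly_prod)
qed auto

section \<open>Hasse's bound\<close>

text \<open>
Written with the values of the cubic, the forms at an affine abscissa show the discriminant of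
\<open>lead X\<^sup>2 - mid X + last\<close>: it is 16 times the product of the two values of the cubic.
\<close>

lemma mid_form_affine:
  "mid_form a b c t x 1 = 2 * (cubic a b c x + cubic a b c t - (a + t + x) * (x - t)\<^sup>2)"
  by (simp add: mid_form_def cubic_def algebra_simps power2_eq_square power3_eq_cube)

lemma last_form_affine:
  "(x - t)\<^sup>2 * last_form a b c t x 1 =
     (cubic a b c x + cubic a b c t - (a + t + x) * (x - t)\<^sup>2)\<^sup>2 - 4 * cubic a b c t * cubic a b c x"
  by (simp add: last_form_def cubic_def algebra_simps power2_eq_square power3_eq_cube)

text \<open>
This makes the abscissa \<open>t\<^sup>p\<close> a rational point: \<open>F(t\<^sup>p) / F(t)\<close> is the square of \<open>F(t) ^ ((p - 1) / 2)\<close>.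
\<close>

lemma cubic_frobenius:
  fixes a b c :: "'p::prime_card mod_ring"
  shows "cubic [:a:] [:b:] [:c:] ([:0, 1:] ^ CARD('p)) = cubic [:a:] [:b:] [:c:] [:0, 1:] ^ CARD('p)"
proof -
  have char: "prime CHAR('p mod_ring poly)" "CARD('p) = CHAR('p mod_ring poly)"
    by (simp_all add: CHAR_mod_ring prime_card)
  have const: "[:x:] ^ CARD('p) = [:x:]" for x :: "'p mod_ring"
    using finite_field_power_card_eq_same[of x] by (simp add: poly_const_pow)
  show ?thesis unfolding cubic_def
    by (simp only: freshmans_dream[OF char] power_mult_distrib const power_mult[symmetric] mult.commute)
qed

text \<open>
The neighbours of the point \<open>P\<close> with abscissa \<open>X = t\<^sup>p\<close> are known explicitly. Their
abscissas are \<open>N s / w\<^sup>2\<close> for \<open>s = 1, -1\<close>, where \<open>w = t\<^sup>p - t\<close> is the product of all linear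
polynomials and \<open>N s = F * (F ^ m - s)\<^sup>2 - (a + t + X) * w\<^sup>2\<close> with \<open>m = (p - 1) / 2\<close>. By
Euler's criterion the factor of \<open>w\<^sup>2\<close> that cancels is \<open>D s\<close>: it has a double root where
\<open>chi F = s\<close> and a simple one where \<open>F\<close> vanishes. Its degree is \<open>p + s S\<close>, so that character sum
and height of the neighbour determine each other. Only an upper bound for the
heights has to be computed, since the two heights add up to \<open>2 p + 2\<close>.
\<close>

theorem hasse_bound:
  fixes a b c :: "'p::prime_card mod_ring"
  defines "F \<equiv> [:c, b, a, 1:]"
  assumes p2: "2 < CARD('p)" and squarefree: "coprime F (pderiv F)"
  shows "(\<Sum>x\<in>UNIV. chi (poly F x))\<^sup>2 \<le> 4 * int CARD('p)"
proof -
  let ?p = "CARD('p)"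
  define m where "m = (?p - 1) div 2"
  have odd: "odd ?p" using prime_card p2 prime_odd_nat by blast
  hence pm: "?p = 2 * m + 1" unfolding m_def using p2 by (auto elim: oddE)
  define S where "S = (\<Sum>x\<in>UNIV. chi (poly F x))"
  define t where "t = ([:0, 1:] :: 'p mod_ring poly)"
  define X where "X = t ^ ?p"
  define w where "w = (\<Prod>x\<in>(UNIV::'p mod_ring set). [:- x, 1:])"
  have w: "X - t = w" by (simp add: w_def prod_all_linear_factors X_def t_def)
  have w0: "w \<noteq> 0" unfolding w_def by (subst prod_zero_iff) auto
  have two: "(2 :: 'p mod_ring) \<noteq> 0" using nat_mod_ring_neq_0[of 2, where ?'p = 'p] p2 by simp
  have F: "cubic [:a:] [:b:] [:c:] t = F"
    by (simp add: cubic_def t_def F_def power2_eq_square power3_eq_cube)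
  have FX: "cubic [:a:] [:b:] [:c:] X = F ^ ?p"
    using cubic_frobenius[of a b c] by (simp add: X_def F t_def[symmetric])
  have F': "cubic_deriv [:a:] [:b:] t = pderiv F"
    by (simp add: cubic_deriv_def t_def F_def power2_eq_square numeral_poly pderiv_pCons)
  define L where "L s = (\<Prod>x\<in>{x. chi (poly F x) = s}. [:- x, 1:])" for s
  define D where "D s = L s * L s * L 0" for s
  have L_split: "L s * L (- s) * L 0 = w" if "s \<in> {1, -1}" for s
  proof -
    have "w = (\<Prod>x\<in>{x. chi (poly F x) = 1} \<union> {x. chi (poly F x) = -1} \<union> {x. chi (poly F x) = 0}. [:- x, 1:])"
      unfolding w_def using chi_cases by (intro prod.cong) auto
    also have "\<dots> = L 1 * L (-1) * L 0"
      unfolding L_def by (subst prod.union_disjoint; (subst prod.union_disjoint)?) auto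
    finally show ?thesis using that by (auto simp: mult_ac)
  qed
  have DD: "D s * D (- s) = w\<^sup>2" if "s \<in> {1, -1}" for s
    unfolding D_def L_split[OF that, symmetric] by (simp add: power2_eq_square mult_ac)
  have D0: "D s \<noteq> 0" if "s \<in> {1, -1}" for s using DD[OF that] w0 by auto
  define U where "U = cubic [:a:] [:b:] [:c:] X + cubic [:a:] [:b:] [:c:] t - ([:a:] + t + X) * (X - t)\<^sup>2"
  have Fp: "F ^ ?p = F * (F ^ m)\<^sup>2" unfolding pm by (simp add: power_mult[symmetric] mult.commute)
  have Fm: "F ^ (m + 1) = F * F ^ m" by simp
  define N where "N s = U - 2 * of_int s * F ^ (m + 1)" for s
  have N: "N s = F * (F ^ m - of_int s)\<^sup>2 - ([:a:] + t + X) * w\<^sup>2" if "s \<in> {1, -1}" for s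
  proof -
    have s: "(of_int s)\<^sup>2 = (1 :: 'p mod_ring poly)" using that by auto
    have "N s = F * (F ^ m)\<^sup>2 + F * (of_int s)\<^sup>2 - ([:a:] + t + X) * w\<^sup>2 - 2 * of_int s * (F * F ^ m)"
      unfolding N_def U_def FX F w Fp Fm s by simp
    thus ?thesis by (simp add: power2_diff distrib_left right_diff_distrib mult_ac)
  qed
  (* Euler's criterion: F ^ m takes the value chi F, so F ^ m - s vanishes where chi F = s. *)
  have D_dvd_N: "D s dvd N s" if "s \<in> {1, -1}" for s
  proof -
    have L0: "L 0 dvd F" unfolding L_def by (intro prod_linear_dvd) auto
    have Ls: "L s dvd F ^ m - of_int s" unfolding L_def
    proof (intro prod_linear_dvd)
      fix x assume "x \<in> {x. chi (poly F x) = s}"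
      thus "poly (F ^ m - of_int s) x = 0"
        using chi_euler[OF p2, of "poly F x"] by (auto simp: m_def poly_power of_int_poly)
    qed simp
    have "D s dvd F * (F ^ m - of_int s)\<^sup>2"
      unfolding D_def power2_eq_square by (metis L0 Ls mult_dvd_mono mult.commute)
    moreover have "D s dvd w\<^sup>2" using DD[OF that] by (metis dvd_triv_left)
    ultimately show ?thesis unfolding N[OF that] by (blast intro: dvd_diff dvd_mult)
  qed
  define r where "r s = N s div D s" for s
  have r: "N s = D s * r s" if "s \<in> {1, -1}" for s using D_dvd_N[OF that] by (simp add: r_def)
  have neg: "- s \<in> {1, -1}" if "s \<in> {1, -1}" for s :: int using that by auto
  have lead: "lead_form t X 1 = D (- s) * D s" if "s \<in> {1, -1}" for s
    using DD[OF that] by (simp add: lead_form_def w mult.commute)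
  have mid: "mid_form [:a:] [:b:] [:c:] t X 1 = D (- s) * r (- s) + r s * D s" if "s \<in> {1, -1}" for s
    using that by (simp add: mid_form_affine mult.commute[of "r s"] r[symmetric, OF that]
      r[symmetric, OF neg[OF that]] U_def[symmetric] N_def)
  have last: "last_form [:a:] [:b:] [:c:] t X 1 = r s * r (- s)" if "s \<in> {1, -1}" for s
  proof -
    have "w\<^sup>2 * last_form [:a:] [:b:] [:c:] t X 1 = U\<^sup>2 - 4 * F * F ^ ?p"
      using last_form_affine[of X t] by (simp add: w U_def FX F)
    also have "\<dots> = U\<^sup>2 - (2 * of_int s * (F * F ^ m))\<^sup>2"
      using that unfolding Fp by (auto simp: power_mult_distrib power2_eq_square mult_ac)
    also have "\<dots> = N s * N (- s)" unfolding N_def Fm power2_eq_square square_diff_square_factored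
      by (simp add: mult.commute)
    also have "\<dots> = w\<^sup>2 * (r s * r (- s))"
      by (simp add: r[OF that] r[OF neg[OF that]] DD[OF that, symmetric] mult_ac)
    finally show ?thesis using w0 by simp
  qed
  have copX: "coprime X 1" by simp
  have smooth: "coprime (cubic [:a:] [:b:] [:c:] t) (cubic_deriv [:a:] [:b:] t)"
    using squarefree by (simp add: F F')
  have cop: "coprime (r s) (D (- s))" and tr: "translates [:a:] [:b:] [:c:] t (r s, D (- s)) (X, 1)"
    if "s \<in> {1, -1}" for s
  proof -
    note * = lead[OF neg[OF that]] mid[OF neg[OF that]] last[OF neg[OF that]]
    show "coprime (r s) (D (- s))" using coprime_cofactors[OF copX smooth two *] by simp
    show "translates [:a:] [:b:] [:c:] t (r s, D (- s)) (X, 1)"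
      using translates_sym[OF cofactors_translate[OF *]] by simp
  qed
  have card1: "int (card {x. chi (poly F x) = 1}) - int (card {x. chi (poly F x) = -1}) = S"
  proof -
    have "S = (\<Sum>x\<in>UNIV. (if chi (poly F x) = 1 then 1 else 0) - (if chi (poly F x) = -1 then 1 else 0))"
      unfolding S_def
    proof (intro sum.cong refl)
      fix x
      show "chi (poly F x) = (if chi (poly F x) = 1 then 1 else 0) - (if chi (poly F x) = -1 then 1 else 0)"
        using chi_cases[of "poly F x"] by auto
    qed
    thus ?thesis by (simp add: sum_subtractf sum.If_cases)
  qed
  have card2: "card {x. chi (poly F x) = 1} + card {x. chi (poly F x) = -1} + card {x. chi (poly F x) = 0} = ?p"
  proof -
    have "card (UNIV :: 'p mod_ring set) = card ({x. chi (poly F x) = 1} \<union> {x. chi (poly F x) = -1} \<union> {x. chi (poly F x) = 0})"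
      using chi_cases by (intro arg_cong[of _ _ card]) auto
    also have "\<dots> = card {x. chi (poly F x) = 1} + card {x. chi (poly F x) = -1} + card {x. chi (poly F x) = 0}"
      by (subst card_Un_disjoint; (subst card_Un_disjoint)?) auto
    finally show ?thesis by simp
  qed
  have degD: "int (degree (D s)) = int ?p + s * S" if "s \<in> {1, -1}" for s
  proof -
    have L_nz: "L j \<noteq> 0" for j unfolding L_def by (subst prod_zero_iff) auto
    have "degree (D s) = 2 * card {x. chi (poly F x) = s} + card {x. chi (poly F x) = 0}"
      using L_nz by (simp add: D_def degree_mult_eq) (simp add: L_def degree_prod_linear)
    thus ?thesis using card1 card2 that by auto
  qed
  have degX: "degree X = ?p" by (simp add: X_def t_def degree_power_eq)
  have degN: "degree (N s) \<le> 2 * ?p + 1" for s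
  proof -
    have U: "2 * U = 2 * (X * (t * (X + t)) + [:2 * a:] * (t * X) + [:b:] * (X + t) + [:2 * c:])"
      using mid_form_affine[of "[:a:]" "[:b:]" "[:c:]" t X]
      by (simp add: U_def mid_form_def numeral_poly algebra_simps)
    have "2 = [:2 :: 'p mod_ring:]" by (simp add: numeral_poly)
    hence "(2 :: 'p mod_ring poly) \<noteq> 0" using two by (metis pCons_eq_0_iff)
    hence U: "U = X * (t * (X + t)) + [:2 * a:] * (t * X) + [:b:] * (X + t) + [:2 * c:]"
      using U by (metis mult_cancel_left)
    have dt: "degree t = 1" by (simp add: t_def)
    have 1: "degree (X + t) \<le> ?p" using degX dt p2 by (intro degree_add_le) auto
    have 2: "degree (t * (X + t)) \<le> ?p + 1" using degree_mult_le[of t "X + t"] 1 dt by linarith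
    have 3: "degree (X * (t * (X + t))) \<le> 2 * ?p + 1"
      using degree_mult_le[of X "t * (X + t)"] 2 degX by linarith
    have 4: "degree ([:2 * a:] * (t * X)) \<le> 2 * ?p + 1"
      using degree_mult_le[of "[:2 * a:]" "t * X"] degree_mult_le[of t X] dt degX by simp
    have 5: "degree ([:b:] * (X + t)) \<le> 2 * ?p + 1"
      using degree_mult_le[of "[:b:]" "X + t"] 1 by simp
    have U: "degree U \<le> 2 * ?p + 1" unfolding U by (intro degree_add_le 3 4 5) simp
    have "degree F = 3" by (simp add: F_def)
    hence "degree (F ^ (m + 1)) \<le> 2 * ?p + 1"
      using degree_power_le[of F "m + 1"] p2 pm by simp
    hence "degree (2 * of_int s * F ^ (m + 1)) \<le> 2 * ?p + 1"
      using degree_mult_le[of "2 * of_int s" "F ^ (m + 1)"]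
      degree_mult_le[of 2 "of_int s :: 'p mod_ring poly"] by (simp add: of_int_poly)
    thus ?thesis unfolding N_def using U by (intro degree_diff_le)
  qed
  have height_le: "int (height (r s, D (- s))) \<le> int ?p + 1 - s * S" if "s \<in> {1, -1}" for s
  proof -
    have "int (degree (r s)) \<le> int ?p + 1 - s * S"
    proof (cases "r s = 0")
      case False
      hence "degree (N s) = degree (D s) + degree (r s)"
        using r[OF that] D0[OF that] by (simp add: degree_mult_eq)
      thus ?thesis using degN[of s] degD[OF that] by linarith
    next
      case True
      thus ?thesis using degD[OF neg[OF that]] by simp
    qed
    thus ?thesis using degD[OF neg[OF that]] by (simp add: height_def)
  qed
  have heightX: "height (X, 1) = ?p" by (simp add: height_def degX)
  have height: "int (height (r s, D (- s))) = int (height (X, 1)) + 1 - s * S" if "s \<in> {1, -1}" for s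
  proof -
    have "height (r s, D (- s)) + height (r (- s), D s) = 2 * ?p + 2"
      using height_forms[of X 1 a b c] height_cofactors[of "r s" "D (- s)" "r (- s)" "D s"] heightX
        D0[OF that] D0[OF neg[OF that]]
      unfolding t_def[symmetric] by (simp add: lead[OF that] mid[OF that] last[OF that])
    thus ?thesis using height_le[OF that] height_le[OF neg[OF that]] heightX by simp
  qed
  (* Walk away from P in the direction in which the heights decrease first. *)
  define s where "s = (if S < 0 then - 1 else 1 :: int)"
  have s: "s \<in> {1, -1}" "0 \<le> s * S" "(s * S)\<^sup>2 = S\<^sup>2" by (auto simp: s_def)
  have "0 \<le> int n ^ 2 - s * S * int n + int ?p" for n
    using translate_sequence_nonneg[of a b c "r s" "D (- s)" X 1 "s * S" n]
      two smooth cop[OF s(1)] copX tr[OF s(1)] height[OF s(1)] heightX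
    unfolding t_def by simp
  from discriminant_bound[OF odd this s(2)] show ?thesis using s(3) by (simp add: S_def)
qed

section \<open>Counting the admissible parameters\<close>

lemma ex_nonresidue:
  assumes "2 < CARD('p::prime_card)"
  shows "\<exists>n :: 'p mod_ring. chi n = -1"
proof (rule ccontr)
  assume "\<nexists>n :: 'p mod_ring. chi n = -1"
  hence "surj (\<lambda>y :: 'p mod_ring. y\<^sup>2)"
    by (fastforce simp: chi_def surj_def split: if_splits)
  hence "inj (\<lambda>y :: 'p mod_ring. y\<^sup>2)" by (rule finite_UNIV_surj_inj[OF finite])
  hence "(1 :: 'p mod_ring) = -1" by (rule injD) simp
  hence "of_nat 2 = (0 :: 'p mod_ring)" by (simp add: eq_neg_iff_add_eq_0)
  thus False using nat_mod_ring_neq_0[of 2, where ?'p = 'p] assms by simp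
qed

lemma sum_chi:
  assumes p2: "2 < CARD('p::prime_card)"
  shows "(\<Sum>x\<in>UNIV. chi (x :: 'p mod_ring)) = 0"
proof -
  obtain n :: "'p mod_ring" where n: "chi n = -1" using ex_nonresidue[OF p2] by blast
  hence n0: "n \<noteq> 0" by auto
  have "(\<Sum>x\<in>UNIV. chi (x :: 'p mod_ring)) = (\<Sum>x\<in>UNIV. chi (n * x))"
    by (rule sum.reindex_bij_witness[of _ "\<lambda>x. n * x" "\<lambda>x. x / n"]) (use n0 in auto)
  also have "\<dots> = - (\<Sum>x\<in>UNIV. chi (x :: 'p mod_ring))" by (simp add: chi_mult[OF p2] n sum_negf)
  finally show ?thesis by simp
qed

lemma sum_chi_affine:
  assumes p2: "2 < CARD('p::prime_card)" and "b \<noteq> 0"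
  shows "(\<Sum>x\<in>UNIV. chi (a + b * x :: 'p mod_ring)) = 0"
proof -
  have "(\<Sum>x\<in>UNIV. chi (a + b * x)) = (\<Sum>x\<in>UNIV. chi (x :: 'p mod_ring))"
    by (rule sum.reindex_bij_witness[of _ "\<lambda>x. (x - a) / b" "\<lambda>x. a + b * x"])
      (use \<open>b \<noteq> 0\<close> in auto)
  thus ?thesis using sum_chi[OF p2] by simp
qed

lemma sum_over_nonzero:
  "(\<Sum>x\<in>UNIV - {0}. f x) = (\<Sum>x\<in>UNIV. f x) - f 0" for f :: "'a::{finite,zero} \<Rightarrow> 'b::ab_group_add"
  by (simp add: sum_diff1)

text \<open>
For \<open>x \<noteq> 0\<close> the argument is \<open>x\<^sup>2 * (a + b / x)\<close>, so the substitution of \<open>1 / x\<close> for \<open>x\<close> leaves the sum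
of the character over an affine function, up to the term for 0.
\<close>

lemma sum_chi_quadratic:
  assumes p2: "2 < CARD('p::prime_card)" and "b \<noteq> 0"
  shows "(\<Sum>x\<in>UNIV. chi (x * (a * x + b) :: 'p mod_ring)) = - chi a"
proof -
  have "(\<Sum>x\<in>UNIV. chi (x * (a * x + b))) = (\<Sum>x\<in>UNIV - {0}. chi (x * (a * x + b)))"
    by (simp add: sum_over_nonzero)
  also have "\<dots> = (\<Sum>x\<in>UNIV - {0}. chi (a + b * inverse x))"
  proof (intro sum.cong refl)
    fix x :: "'p mod_ring" assume "x \<in> UNIV - {0}"
    hence x: "x \<noteq> 0" by simp
    have "x\<^sup>2 * (a + b * inverse x) = x * (a * x) + x * b * (x * inverse x)"
      by (simp add: power2_eq_square distrib_left mult_ac)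
    hence "x * (a * x + b) = x\<^sup>2 * (a + b * inverse x)" using x by (simp add: distrib_left)
    thus "chi (x * (a * x + b)) = chi (a + b * inverse x)" using x by (simp only: chi_mult[OF p2] chi_square[OF x] mult_1)
  qed
  also have "\<dots> = (\<Sum>x\<in>UNIV - {0}. chi (a + b * x))"
    by (rule sum.reindex_bij_witness[of _ inverse inverse]) auto
  also have "\<dots> = - chi a" using sum_chi_affine[OF assms, of a] by (simp add: sum_over_nonzero)
  finally show ?thesis .
qed

lemma sum_chi_shifted_quadratic:
  assumes p2: "2 < CARD('p::prime_card)" and "a * r + b \<noteq> 0"
  shows "(\<Sum>x\<in>UNIV. chi ((x - r) * (a * x + b) :: 'p mod_ring)) = - chi a"
proof -
  have "(\<Sum>x\<in>UNIV. chi ((x - r) * (a * x + b))) = (\<Sum>x\<in>UNIV. chi (x * (a * x + (a * r + b))))"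
    by (rule sum.reindex_bij_witness[of _ "\<lambda>x. x + r" "\<lambda>x. x - r"]) (auto simp: algebra_simps)
  thus ?thesis using sum_chi_quadratic[OF assms, of a] by simp
qed

text \<open>
The membership condition of \<open>A_set\<close>, read in the field.
\<close>

definition admissible :: "'a::field \<Rightarrow> bool" where
  "admissible a \<longleftrightarrow> chi a = -1 \<and> chi (1 - 4 * a) = -1 \<and> chi (1 - 4 * inverse a) = -1"

lemma small_neq_0:
  assumes "5 < CARD('p::prime_card)"
  shows "(2 :: 'p mod_ring) \<noteq> 0" "(3 :: 'p mod_ring) \<noteq> 0" "(4 :: 'p mod_ring) \<noteq> 0" "(5 :: 'p mod_ring) \<noteq> 0"
    "(15 :: 'p mod_ring) \<noteq> 0" "(16 :: 'p mod_ring) \<noteq> 0"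
proof -
  have *: "(of_nat k :: 'p mod_ring) \<noteq> 0" if "k \<in> {2,3,4,5}" for k
    using that assms by (intro nat_mod_ring_neq_0) auto
  show "(2 :: 'p mod_ring) \<noteq> 0" "(3 :: 'p mod_ring) \<noteq> 0" "(4 :: 'p mod_ring) \<noteq> 0" "(5 :: 'p mod_ring) \<noteq> 0"
    using *[of 2] *[of 3] *[of 4] *[of 5] by simp_all
  hence "(3 :: 'p mod_ring) * 5 \<noteq> 0" "(4 :: 'p mod_ring) * 4 \<noteq> 0" by (metis mult_eq_0_iff)+
  thus "(15 :: 'p mod_ring) \<noteq> 0" "(16 :: 'p mod_ring) \<noteq> 0" by simp_all
qed

lemma chi_4: "5 < CARD('p::prime_card) \<Longrightarrow> chi (4 :: 'p mod_ring) = 1"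
  using chi_square[of "2 :: 'p mod_ring"] small_neq_0(1)[where ?'p = 'p] by simp

lemma chi_eq_1_if_1_minus_4_mult:
  assumes "5 < CARD('p::prime_card)" and "1 - 4 * a = (0 :: 'p mod_ring)"
  shows "chi a = 1"
proof -
  from assms(2) have "4 * a = 1" by simp
  hence "a = inverse 4" by (metis inverse_unique)
  moreover have "(inverse 2)\<^sup>2 = inverse (4 :: 'p mod_ring)" by (subst power_inverse) simp
  ultimately have "a = (inverse 2)\<^sup>2" by metis
  thus ?thesis using chi_square[of "inverse 2 :: 'p mod_ring"] small_neq_0[OF assms(1)] by simp
qed

lemma mult_1_minus_4_inverse:
  assumes "a \<noteq> (0 :: 'a::field)"
  shows "a * (1 - 4 * inverse a) = a - 4"
proof -
  have "a * (1 - 4 * inverse a) = a - 4 * (a * inverse a)" by (simp add: right_diff_distrib mult_ac)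
  thus ?thesis using assms by simp
qed

lemma chi_eq_1_if_1_minus_4_inverse:
  assumes "5 < CARD('p::prime_card)" and "a \<noteq> (0 :: 'p mod_ring)" and "1 - 4 * inverse a = 0"
  shows "chi a = 1"
proof -
  have "a - 4 = 0" using mult_1_minus_4_inverse[OF assms(2)] assms(3) by simp
  hence "a = 4" by simp
  thus ?thesis using chi_4[OF assms(1)] by simp
qed

text \<open>
The right-hand side is the expansion of
\<open>(1 - chi a) * (1 - chi (1 - 4 a)) * (1 - chi (1 - 4 / a))\<close>, where \<open>chi (1 - 4 / a)\<close> is replaced by
\<open>chi a * chi (a - 4)\<close>. The last two factors could only be 1, instead of 0 or 2, at \<open>a = 1/4\<close> and
\<open>a = 4\<close>; there \<open>a\<close> is a square and the first factor vanishes.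
\<close>

lemma admissible_indicator:
  fixes a :: "'p::prime_card mod_ring"
  assumes p5: "5 < CARD('p)" and a: "a \<noteq> 0"
  shows "8 * (if admissible a then 1 else 0) =
    1 - chi a - chi (1 - 4 * a) + chi (a * (1 - 4 * a)) - chi (a * (a - 4)) + chi (a - 4)
      + chi (a * (a - 4) * (1 - 4 * a)) - chi ((a - 4) * (1 - 4 * a))"
proof -
  from p5 have p2: "2 < CARD('p)" by simp
  note n = small_neq_0[OF p5]
  have "chi (a - 4) = chi (a * (1 - 4 * inverse a))" using mult_1_minus_4_inverse[OF a] by simp
  hence m: "chi (a - 4) = chi a * chi (1 - 4 * inverse a)"
    by (metis chi_mult[OF p2])
  show ?thesis unfolding chi_mult[OF p2] m admissible_def
    using chi_cases[of a] chi_cases[of "1 - 4 * a"] chi_cases[of "1 - 4 * inverse a"] a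
      chi_eq_1_if_1_minus_4_mult[OF p5, of a] chi_eq_1_if_1_minus_4_inverse[OF p5 a]
    by auto
qed

theorem card_admissible:
  assumes p5: "5 < CARD('p::prime_card)"
  shows "8 * int (card {a :: 'p mod_ring. admissible a}) =
    int CARD('p) + 1 + (\<Sum>z\<in>UNIV. chi (z * (z - 4) * (1 - 4 * z) :: 'p mod_ring))"
proof -
  from p5 have p2: "2 < CARD('p)" by simp
  note n = small_neq_0[OF p5]
  have n': "(-4 :: 'p mod_ring) \<noteq> 0" using n by simp
  let ?U = "UNIV :: 'p mod_ring set" and ?V = "UNIV - {0} :: 'p mod_ring set"
  have "8 * int (card {a :: 'p mod_ring. admissible a}) = (\<Sum>a\<in>?U. 8 * (if admissible a then 1 else 0))"
    by (simp add: sum.If_cases sum_distrib_left[symmetric])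
  also have "\<dots> = (\<Sum>a\<in>?V. 8 * (if admissible a then 1 else 0))"
    by (simp add: sum_over_nonzero admissible_def)
  also have "\<dots> = (\<Sum>a\<in>?V. 1 - chi a - chi (1 - 4 * a) + chi (a * (1 - 4 * a)) - chi (a * (a - 4))
      + chi (a - 4) + chi (a * (a - 4) * (1 - 4 * a)) - chi ((a - 4) * (1 - 4 * a)))"
    by (intro sum.cong refl admissible_indicator p5) auto
  also have "\<dots> = (\<Sum>a\<in>?V. 1) - (\<Sum>a\<in>?V. chi a) - (\<Sum>a\<in>?V. chi (1 - 4 * a))
      + (\<Sum>a\<in>?V. chi (a * (1 - 4 * a))) - (\<Sum>a\<in>?V. chi (a * (a - 4))) + (\<Sum>a\<in>?V. chi (a - 4))
      + (\<Sum>a\<in>?V. chi (a * (a - 4) * (1 - 4 * a))) - (\<Sum>a\<in>?V. chi ((a - 4) * (1 - 4 * a)))"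
    by (simp only: sum.distrib sum_subtractf)
  also have "(\<Sum>a\<in>?V. 1) = int CARD('p) - 1" by (simp add: sum_over_nonzero)
  also have "(\<Sum>a\<in>?V. chi a) = 0" by (simp add: sum_over_nonzero sum_chi[OF p2])
  also have "(\<Sum>a\<in>?V. chi (1 - 4 * a)) = -1"
    using sum_chi_affine[OF p2 n', of 1] by (simp add: sum_over_nonzero)
  also have "(\<Sum>a\<in>?V. chi (a * (1 - 4 * a))) = - chi (-4 :: 'p mod_ring)"
    using sum_chi_quadratic[OF p2, of 1 "-4"] by (simp add: sum_over_nonzero)
  also have "(\<Sum>a\<in>?V. chi (a * (a - 4))) = -1"
    using sum_chi_quadratic[OF p2 n', of 1] by (simp add: sum_over_nonzero)
  also have "(\<Sum>a\<in>?V. chi (a - 4)) = - chi (-4 :: 'p mod_ring)"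
    using sum_chi_affine[OF p2, of 1 "-4"] by (simp add: sum_over_nonzero)
  also have "(\<Sum>a\<in>?V. chi ((a - 4) * (1 - 4 * a))) = - 2 * chi (-4 :: 'p mod_ring)"
    using sum_chi_shifted_quadratic[OF p2, of "-4" 4 1] n by (simp add: sum_over_nonzero)
  also have "(\<Sum>a\<in>?V. chi (a * (a - 4) * (1 - 4 * a))) = (\<Sum>z\<in>UNIV. chi (z * (z - 4) * (1 - 4 * z) :: 'p mod_ring))"
    by (simp add: sum_over_nonzero)
  finally show ?thesis by simp
qed

lemma coprime_linear:
  fixes g :: "'a::field_gcd poly"
  assumes "poly g r \<noteq> 0"
  shows "coprime [:- r, 1:] g"
  using assms by (intro prime_elem_imp_coprime prime_elem_linear_field_poly) (auto simp: poly_eq_0_iff_dvd)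

text \<open>
The substitution \<open>x = -4 z\<close> turns the product into \<open>x (x + 1) (x + 16) / 16\<close>, a monic cubic up to a
square. Its roots 0, -1, -16 are distinct because \<open>p\<close> does not divide \<open>1 * 15 * 16\<close>.
\<close>

theorem sum_chi_curve_bound:
  assumes p5: "5 < CARD('p::prime_card)"
  shows "(\<Sum>z\<in>UNIV. chi (z * (z - 4) * (1 - 4 * z) :: 'p mod_ring))\<^sup>2 \<le> 4 * int CARD('p)"
proof -
  from p5 have p2: "2 < CARD('p)" by simp
  note n = small_neq_0[OF p5]
  define F where "F = [:0, 16, 17, 1 :: 'p mod_ring:]"
  have F: "F = [:- 0, 1:] * ([:- (-1), 1:] * [:- (-16), 1:])" by (simp add: F_def)
  have F': "pderiv F = [:16, 34, 3:]" by (simp add: F_def pderiv_pCons)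
  (* The derivative takes the values 16, -15, 240 at the roots 0, -1, -16. *)
  have "(16 :: 'p mod_ring) * 15 \<noteq> 0" using n by (metis mult_eq_0_iff)
  hence "(240 :: 'p mod_ring) \<noteq> 0" by simp
  hence "coprime ([:- 0, 1:] * ([:- (-1), 1:] * [:- (-16), 1:])) (pderiv F)"
    unfolding coprime_mult_left_iff F' using n by (intro conjI coprime_linear) auto
  hence "coprime F (pderiv F)" by (metis F)
  hence bound: "(\<Sum>x\<in>UNIV. chi (poly F x))\<^sup>2 \<le> 4 * int CARD('p)"
    using hasse_bound[OF p2, of 0 16 17] by (simp add: F_def)
  have 16: "chi (16 :: 'p mod_ring) = 1" using chi_square[of "4 :: 'p mod_ring"] n by simp
  have "(\<Sum>x\<in>UNIV. chi (poly F x)) = (\<Sum>z\<in>UNIV. chi (poly F (- 4 * z)))"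
    by (rule sum.reindex_bij_witness[of _ "\<lambda>z. - 4 * z" "\<lambda>x. x / (- 4)"]) (use n in auto)
  also have "poly F (- 4 * z) = 16 * (z * (z - 4) * (1 - 4 * z))" for z
    by (simp add: F_def algebra_simps)
  hence "chi (poly F (- 4 * z)) = chi (z * (z - 4) * (1 - 4 * z))" for z
    by (metis chi_mult[OF p2] 16 mult_1)
  hence "(\<Sum>z\<in>UNIV. chi (poly F (- 4 * z))) = (\<Sum>z\<in>UNIV. chi (z * (z - 4) * (1 - 4 * z) :: 'p mod_ring))"
    by simp
  finally show ?thesis using bound by simp
qed

section \<open>Derivative equations between points of equal parity\<close>

lemma scaled_inverse_diff_iff:
  assumes "u \<noteq> 0" "v \<noteq> (0 :: 'a::field)"
  shows "k * inverse u - l * inverse v = w \<longleftrightarrow> w * (u * v) = k * v - l * u"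
proof -
  have "(k * inverse u - l * inverse v) * (u * v) = k * v * (u * inverse u) - l * u * (v * inverse v)"
    by (simp add: algebra_simps)
  also have "\<dots> = k * v - l * u" using assms by simp
  finally show ?thesis using assms by (metis mult_eq_0_iff mult_right_cancel)
qed

lemma chi_differ_iff:
  assumes "2 < CARD('p::prime_card)" "x \<noteq> 0" "y \<noteq> (0 :: 'p mod_ring)"
  shows "((chi x = 1) \<noteq> (chi y = 1)) \<longleftrightarrow> chi (x * y) = -1"
  using chi_cases[of x] chi_cases[of y] assms by (auto simp: chi_mult[OF assms(1)])

lemma nonresidue_not_square:
  assumes "2 < CARD('p::prime_card)" "chi (d :: 'p mod_ring) = -1" "s \<noteq> 0"
  shows "y\<^sup>2 \<noteq> s\<^sup>2 * d"
proof
  assume "y\<^sup>2 = s\<^sup>2 * d"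
  moreover have "chi (s\<^sup>2 * d) = -1" using assms by (simp add: chi_mult chi_square)
  ultimately have "chi (y\<^sup>2) = -1" by simp
  thus False by (cases "y = 0") (auto simp: chi_square)
qed

text \<open>
The discriminant of \<open>x\<^sup>2 + s x + d s\<^sup>2\<close> is \<open>s\<^sup>2 (1 - 4 d)\<close>.
\<close>

lemma no_root_if_nonresidue:
  assumes "2 < CARD('p::prime_card)" "chi (1 - 4 * d :: 'p mod_ring) = -1" "s \<noteq> 0"
  shows "x * (x + s) \<noteq> - (d * s\<^sup>2)"
proof
  assume "x * (x + s) = - (d * s\<^sup>2)"
  moreover have "(2 * x + s)\<^sup>2 = 4 * (x * (x + s)) + s\<^sup>2" by (simp add: power2_eq_square algebra_simps)
  ultimately have "(2 * x + s)\<^sup>2 = s\<^sup>2 * (1 - 4 * d)" by (simp add: right_diff_distrib mult_ac)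
  thus False using nonresidue_not_square[OF assms] by blast
qed

lemma roots_if_residue:
  assumes "5 < CARD('p::prime_card)" "chi (1 - 4 * d :: 'p mod_ring) = 1" "s \<noteq> 0"
  obtains x where "x * (x + s) = - (d * s\<^sup>2)" "x \<noteq> - s - x"
proof -
  note n = small_neq_0[OF assms(1)]
  from assms(2) have "\<exists>r. 1 - 4 * d = r\<^sup>2" unfolding chi_def by (auto split: if_splits)
  then obtain r where r: "1 - 4 * d = r\<^sup>2" by blast
  hence r0: "r \<noteq> 0" using assms(2) by auto
  define x where "x = (s * r - s) * inverse 2"
  have x: "2 * x = s * r - s" using n by (simp add: x_def)
  have "4 * (x * (x + s)) = 2 * x * (2 * x + 2 * s)" by (simp add: algebra_simps)
  also have "\<dots> = s\<^sup>2 * r\<^sup>2 - s\<^sup>2" unfolding x by (simp add: power2_eq_square algebra_simps)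
  also have "\<dots> = 4 * - (d * s\<^sup>2)" unfolding r[symmetric] by (simp add: algebra_simps)
  finally have "x * (x + s) = - (d * s\<^sup>2)" using n by (metis mult_left_cancel)
  moreover have "x \<noteq> - s - x"
  proof
    assume "x = - s - x"
    hence "2 * x + s = 0" by (simp add: algebra_simps)
    thus False using x assms(3) r0 by simp
  qed
  ultimately show ?thesis by (rule that)
qed

text \<open>
A root would give \<open>y = x / s\<close> with \<open>y\<^sup>2 + y + 1 = 0\<close>, hence \<open>y\<^sup>3 = 1\<close>. As \<open>p mod 3 = 2\<close>, Fermat's
theorem \<open>y\<^sup>p = y\<close> then reads \<open>y\<^sup>2 = y\<close>.
\<close>

lemma no_primitive_cube_root:
  assumes "2 < CARD('p::prime_card)" "CARD('p) mod 3 = 2" "s \<noteq> (0 :: 'p mod_ring)"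
  shows "x * (x + s) \<noteq> - s\<^sup>2"
proof
  assume *: "x * (x + s) = - s\<^sup>2"
  define y where "y = x * inverse s"
  have x: "x = y * s" using assms by (simp add: y_def)
  have "s\<^sup>2 * (y * y + y + 1) = 0" using * unfolding x by (simp add: power2_eq_square algebra_simps)
  hence y1: "y * y + y + 1 = 0" using assms by simp
  have "y ^ 3 - 1 = (y - 1) * (y * y + y + 1)" by (simp add: power3_eq_cube algebra_simps)
  hence y3: "y ^ 3 = 1" using y1 by simp
  have "CARD('p) = 3 * (CARD('p) div 3) + 2" using assms(2) mult_div_mod_eq[of 3 "CARD('p)"] by simp
  hence "y ^ CARD('p) = (y ^ 3) ^ (CARD('p) div 3) * y\<^sup>2" by (metis power_add power_mult)
  hence "y = y\<^sup>2" using y3 finite_field_power_card_eq_same[of y] by simp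
  hence "y = 0 \<or> y = 1" by (simp add: power2_eq_square)
  hence "(3 :: 'p mod_ring) = 0" using y1 by auto
  moreover have "CARD('p) \<noteq> 3" using assms(2) by auto
  ultimately show False using nat_mod_ring_neq_0[of 3, where ?'p = 'p] assms(1) by simp
qed

text \<open>
The bit \<open>R\<close> of the map: at 0 it is the parity \<open>e\<close>, which keeps the two preimages of \<open>Y = 0\<close> apart.
\<close>

definition residue_bit :: "bool \<Rightarrow> 'a::field \<Rightarrow> bool" where
  "residue_bit e x \<longleftrightarrow> (chi x = 1) \<noteq> (e \<and> x = 0)"

text \<open>
The map \<open>B_map\<close> in the coordinates parity and residue modulo \<open>p\<close>.
\<close>

definition field_map :: "'a::field \<Rightarrow> 'a \<Rightarrow> bool \<times> 'a \<Rightarrow> bool \<times> 'a" where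
  "field_map a c = (\<lambda>(e, x). let y = x + (if e then c else 0) in
     (residue_bit e y, (if e then a else 1) * inverse y))"

text \<open>
Parities are added by \<open>\<noteq>\<close>; \<open>u\<close> is the input difference and \<open>v\<close> the output difference.
\<close>

definition solutions :: "(bool \<times> 'a::ring \<Rightarrow> bool \<times> 'a) \<Rightarrow> bool \<times> 'a \<Rightarrow> bool \<times> 'a \<Rightarrow> (bool \<times> 'a) set" where
  "solutions F u v = {z.
     (fst (F (fst z \<noteq> fst u, snd z + snd u)) \<noteq> fst (F z)) = fst v \<and>
     snd (F (fst z \<noteq> fst u, snd z + snd u)) - snd (F z) = snd v}"

lemma residue_bit_nonzero [simp]: "x \<noteq> 0 \<Longrightarrow> residue_bit e x \<longleftrightarrow> chi x = 1"
  by (simp add: residue_bit_def)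

lemma residue_bit_zero [simp]: "residue_bit e 0 \<longleftrightarrow> e"
  by (simp add: residue_bit_def)

text \<open>
Equal second components for different parities mean \<open>y = a x\<close> for the shifted arguments \<open>x\<close>, \<open>y\<close>.
Then \<open>chi y = - chi x\<close>, so the first components differ.
\<close>

lemma field_map_inj:
  assumes p2: "2 < CARD('p::prime_card)" and a: "chi a = -1"
  shows "inj (field_map a (c :: 'p mod_ring))"
proof (rule injI)
  have a0: "a \<noteq> 0" using a by auto
  have collision: False if "residue_bit False x = residue_bit True y" "inverse x = a * inverse y"
    for x y :: "'p mod_ring"
  proof (cases "x = 0")
    case True
    hence "y = 0" using that a0 by simp
    thus False using True that by simp
  next
    case False
    hence y: "y \<noteq> 0" using that by auto
    have "a * x = a * inverse y * y * x" using y by (simp add: mult.assoc)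
    also have "\<dots> = y * (inverse x * x)" unfolding that(2)[symmetric] by (simp only: mult_ac)
    also have "\<dots> = y" using False by simp
    finally have "y = a * x" ..
    hence "chi y = - chi x" by (simp add: chi_mult[OF p2] a)
    thus False using that(1) False y chi_cases[of x] by auto
  qed
  fix z z' assume eq: "field_map a c z = field_map a c z'"
  obtain e x e' x' where z: "z = (e, x)" "z' = (e', x')" by (cases z, cases z')
  show "z = z'"
    using eq a0 collision[of x "x' + c"] collision[of x' "x + c"] unfolding z field_map_def
    by (cases e; cases e') (auto simp: Let_def)
qed

text \<open>
The solutions in one parity class, for differences \<open>(False, s)\<close> and \<open>(h, w)\<close>: the shift by \<open>c\<close> has
been undone, and \<open>k\<close> is 1 for even and \<open>a\<close> for odd arguments.
\<close>

definition same_half :: "'a::field \<Rightarrow> bool \<Rightarrow> 'a \<Rightarrow> bool \<Rightarrow> 'a \<Rightarrow> 'a set" where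
  "same_half s e k h w = {x. (residue_bit e (x + s) \<noteq> residue_bit e x) = h \<and>
     k * inverse (x + s) - k * inverse x = w}"

text \<open>
For a difference \<open>(True, s)\<close>, the solutions starting at even arguments form \<open>cross_half 1\<close>. Those
starting at odd arguments are brought to the same shape by running the difference backwards and
changing sign; the sign \<open>i = -1\<close> survives only inside the character.
\<close>

definition cross_half :: "'a::field \<Rightarrow> 'a \<Rightarrow> 'a \<Rightarrow> bool \<Rightarrow> 'a \<Rightarrow> 'a set" where
  "cross_half i s a h w = {x. (residue_bit True (i * (x + s)) \<noteq> residue_bit False (i * x)) = h \<and>
     a * inverse (x + s) - inverse x = w}"

lemma solutions_same_parity:
  fixes a c s w :: "'a::field"
  shows "solutions (field_map a c) (False, s) (h, w) =
     Pair False ` same_half s False 1 h w \<union> (\<lambda>x. (True, x - c)) ` same_half s True a h w"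
proof (rule Set.set_eqI)
  fix z :: "bool \<times> 'a"
  obtain e x where z: "z = (e, x)" by (cases z)
  have c: "x + c + s = x + s + c" by (simp add: add_ac)
  show "z \<in> solutions (field_map a c) (False, s) (h, w) \<longleftrightarrow>
    z \<in> Pair False ` same_half s False 1 h w \<union> (\<lambda>x. (True, x - c)) ` same_half s True a h w"
  proof (cases e)
    case True
    hence z: "z = (True, x)" using z by simp
    have "z \<in> (\<lambda>x. (True, x - c)) ` same_half s True a h w \<longleftrightarrow> x + c \<in> same_half s True a h w"
      unfolding z by (auto simp: image_iff intro!: bexI[of _ "x + c"])
    thus ?thesis unfolding z
      by (auto simp: solutions_def same_half_def field_map_def Let_def c)
  next
    case False
    hence z: "z = (False, x)" using z by simp
    show ?thesis unfolding z
      by (auto simp: solutions_def same_half_def field_map_def Let_def)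
  qed
qed

lemma solutions_opposite_parity:
  "solutions (field_map a c) (True, s) (h, w) \<subseteq>
     Pair False ` cross_half 1 (s + c) a h w \<union> (\<lambda>y. (True, - y - s)) ` cross_half (-1) (s - c) a h w"
proof
  fix z assume *: "z \<in> solutions (field_map a c) (True, s) (h, w)"
  obtain e x where z: "z = (e, x)" by (cases z)
  show "z \<in> Pair False ` cross_half 1 (s + c) a h w \<union>
      (\<lambda>y. (True, - y - s)) ` cross_half (-1) (s - c) a h w"
  proof (cases e)
    case False
    hence z: "z = (False, x)" using z by simp
    have "x \<in> cross_half 1 (s + c) a h w"
      using * unfolding z by (simp add: solutions_def cross_half_def field_map_def Let_def add_ac)
    thus ?thesis unfolding z by blast
  next
    case True
    hence z: "z = (True, x)" using z by simp
    define y where "y = - (x + s)"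
    have y: "- 1 * (y + (s - c)) = x + c" "- 1 * y = x + s" "x = - y - s" by (simp_all add: y_def)
    have "y + (s - c) = - (x + c)" "y = - (x + s)" by (simp_all add: y_def)
    hence inv: "inverse (y + (s - c)) = - inverse (x + c)" "inverse y = - inverse (x + s)"
      by (metis inverse_minus_eq)+
    have "y \<in> cross_half (-1) (s - c) a h w"
      using * unfolding z cross_half_def mem_Collect_eq y(1,2) inv
      by (auto simp: solutions_def field_map_def Let_def)
    thus ?thesis unfolding z using y(3) by blast
  qed
qed

text \<open>
Either one of the two inverted arguments is 0, which forces \<open>s * w = k\<close>, or clearing
denominators gives a quadratic equation for \<open>x\<close>, and \<open>h\<close> tells the character of \<open>x * (x + s)\<close>.
\<close>

lemma same_half_cases:
  fixes s w :: "'p::prime_card mod_ring"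
  assumes p2: "2 < CARD('p)" and s: "s \<noteq> 0" and k: "k \<noteq> 0" and x: "x \<in> same_half s e k h w"
  obtains "x \<in> {0, - s}" "s * w = k"
  | "x \<noteq> 0" "x + s \<noteq> 0" "w * (x * (x + s)) = - (k * s)" "h \<longleftrightarrow> chi (x * (x + s)) = -1"
proof (cases "x \<in> {0, - s}")
  case True
  have "k * inverse s = w" using x True by (auto simp: same_half_def)
  hence "s * w = k" using s by (metis mult.commute mult.left_commute mult.right_neutral right_inverse)
  thus ?thesis using True that(1) by blast
next
  case False
  hence x0: "x \<noteq> 0" "x + s \<noteq> 0" by (auto simp: eq_neg_iff_add_eq_0)
  have "w * (x * (x + s)) = - (k * s)"
    using x scaled_inverse_diff_iff[OF x0(2,1), of k k w] by (simp add: same_half_def algebra_simps)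
  moreover have "h \<longleftrightarrow> chi (x * (x + s)) = -1"
    using x chi_differ_iff[OF p2 x0] x0 by (auto simp: same_half_def)
  ultimately show ?thesis using x0 that(2) by blast
qed

lemma card_two_roots:
  assumes "\<And>x y. x \<in> A \<Longrightarrow> y \<in> A \<Longrightarrow> x * (x + s) = y * (y + s :: 'a::field)"
  shows "card A \<le> 2"
proof (cases "A = {}")
  case False
  then obtain y where y: "y \<in> A" by blast
  have "A \<subseteq> {y, - s - y}"
  proof
    fix x assume "x \<in> A"
    from assms[OF this y] have "(x - y) * (x - (- s - y)) = 0" by (simp add: algebra_simps)
    thus "x \<in> {y, - s - y}" by simp
  qed
  hence "card A \<le> card {y, - s - y}" by (intro card_mono) auto
  also have "\<dots> \<le> 2" by (simp add: card_insert_le_m1)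
  finally show ?thesis .
qed simp

text \<open>
Three cases according to which class admits the exceptional solutions \<open>0\<close> and \<open>- s\<close>. They occur
for \<open>s w = 1\<close> among even and for \<open>s w = a\<close> among odd arguments, and in both cases the
hypotheses leave no generic solution in either class. Otherwise the products \<open>x * (x + s)\<close> of
the two classes differ by the nonresidue \<open>a\<close>, so that \<open>h\<close> selects one class.
\<close>

lemma same_half_card_le_2:
  fixes s w :: "'p::prime_card mod_ring"
  assumes p2: "2 < CARD('p)" and p3: "CARD('p) mod 3 = 2" and s: "s \<noteq> 0" and a: "admissible a"
  shows "card (same_half s False 1 h w) + card (same_half s True a h w) \<le> 2"
proof -
  have a1: "chi a = -1" "chi (1 - 4 * a) = -1" "chi (1 - 4 * inverse a) = -1"
    using a by (auto simp: admissible_def)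
  hence a0: "a \<noteq> 0" "a \<noteq> 1" by auto
  note split0 = same_half_cases[OF p2 s one_neq_zero, of _ False h w]
  note split1 = same_half_cases[OF p2 s a0(1), of _ True h w]
  have scale: "x * (x + s) = - (l * s\<^sup>2)" if "w * (x * (x + s)) = - (k * s)" "s * w = j" "j \<noteq> 0" "k = j * l"
    for x j k l
  proof -
    have "j * (x * (x + s)) = s * (w * (x * (x + s)))" using that(2) by (simp add: mult_ac)
    also have "\<dots> = j * (- (l * s\<^sup>2))" using that(1,4) by (simp add: power2_eq_square mult_ac)
    finally show ?thesis using that(3) by (metis mult_left_cancel)
  qed
  have pair: "card A \<le> 2" if "A \<subseteq> {0, - s}" for A
    using card_mono[OF _ that] card_insert_le_m1[of 2 "{- s}" 0] by simp
  consider "s * w = 1" | "s * w = a" | "s * w \<noteq> 1" "s * w \<noteq> a" by blast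
  thus ?thesis
  proof cases
    case 1
    have "same_half s False 1 h w \<subseteq> {0, - s}"
    proof
      fix x assume "x \<in> same_half s False 1 h w"
      thus "x \<in> {0, - s}"
        by (rule split0) (use scale[OF _ 1, of x 1 1] no_primitive_cube_root[OF p2 p3 s, of x] in auto)
    qed
    moreover have "same_half s True a h w = {}"
    proof (rule equals0I)
      fix x assume "x \<in> same_half s True a h w"
      thus False
        by (rule split1) (use 1 a0 scale[OF _ 1, of x a a] no_root_if_nonresidue[OF p2 a1(2) s, of x] in auto)
    qed
    ultimately show ?thesis using pair by simp
  next
    case 2
    have "same_half s True a h w \<subseteq> {0, - s}"
    proof
      fix x assume "x \<in> same_half s True a h w"
      thus "x \<in> {0, - s}"
        by (rule split1) (use a0 scale[OF _ 2, of x a 1] no_primitive_cube_root[OF p2 p3 s, of x] in auto)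
    qed
    moreover have "same_half s False 1 h w = {}"
    proof (rule equals0I)
      fix x assume "x \<in> same_half s False 1 h w"
      thus False
        by (rule split0) (use 2 a0 scale[OF _ 2, of x 1 "inverse a"]
          no_root_if_nonresidue[OF p2 a1(3) s, of x] in auto)
    qed
    ultimately show ?thesis using pair by simp
  next
    case 3
    have w0: "w \<noteq> 0"
      if "w * (x * (x + s)) = - (k * s)" "k \<noteq> 0" for x k using that s by auto
    have f: "w * (x * (x + s)) = - (1 * s)" "h \<longleftrightarrow> chi (x * (x + s)) = -1" "x * (x + s) \<noteq> 0"
      if "x \<in> same_half s False 1 h w" for x using that 3 by (auto elim!: split0)
    have t: "w * (x * (x + s)) = - (a * s)" "h \<longleftrightarrow> chi (x * (x + s)) = -1" "x * (x + s) \<noteq> 0"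
      if "x \<in> same_half s True a h w" for x using that 3 by (auto elim!: split1)
    have "card A \<le> 2" if A: "\<And>x. x \<in> A \<Longrightarrow> w * (x * (x + s)) = - (k * s)" and k: "k \<noteq> 0" for A k
    proof (rule card_two_roots)
      fix x y assume "x \<in> A" "y \<in> A"
      hence "w * (x * (x + s)) = w * (y * (y + s))" "w \<noteq> 0" using A w0[OF A k] by simp_all
      thus "x * (x + s) = y * (y + s)" by (metis mult_left_cancel)
    qed
    from this[OF f(1) one_neq_zero] this[OF t(1) a0(1)]
    have "card (same_half s False 1 h w) \<le> 2" "card (same_half s True a h w) \<le> 2" by simp_all
    moreover have "same_half s False 1 h w = {} \<or> same_half s True a h w = {}"
    proof (rule ccontr)
      assume "\<not> (same_half s False 1 h w = {} \<or> same_half s True a h w = {})"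
      then obtain x y where x: "x \<in> same_half s False 1 h w" and y: "y \<in> same_half s True a h w" by blast
      have "w * (y * (y + s)) = w * (a * (x * (x + s)))"
        using f(1)[OF x] t(1)[OF y] by (simp add: mult.left_commute[of w a])
      hence "y * (y + s) = a * (x * (x + s))" using w0[OF f(1)[OF x]] by simp
      hence "chi (y * (y + s)) = - chi (x * (x + s))" by (simp add: chi_mult[OF p2] a1)
      moreover have "chi (x * (x + s)) \<noteq> 0" using f(3)[OF x] by simp
      ultimately show False using f(2)[OF x] t(2)[OF y] chi_cases[of "x * (x + s)"] by auto
    qed
    ultimately show ?thesis by auto
  qed
qed

section \<open>Derivative equations between points of different parity, and the converse\<close>

text \<open>
Two generic solutions \<open>x\<close>, \<open>y\<close> would be the roots of a quadratic with
\<open>w x y = s\<close> and \<open>w (x + s) (y + s) = a s\<close>. The product of \<open>x (x + s)\<close> and \<open>y (y + s)\<close> is then \<open>a\<close>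
times a square, while \<open>h\<close> prescribes the same character for both. An exceptional
solution 0 or \<open>- s\<close> fixes \<open>w\<close>, and the quadratic has a discriminant \<open>s\<^sup>2 (1 - 4 a)\<close> or
\<open>a\<^sup>2 s\<^sup>2 (1 - 4 / a)\<close>.
\<close>

lemma cross_half_unique:
  fixes s w :: "'p::prime_card mod_ring"
  assumes p2: "2 < CARD('p)" and a: "admissible a" and i: "i\<^sup>2 = 1"
    and x: "x \<in> cross_half i s a h w" and y: "y \<in> cross_half i s a h w"
  shows "x = y"
proof -
  have a1: "chi a = -1" "chi (1 - 4 * a) = -1" "chi (1 - 4 * inverse a) = -1"
    using a by (auto simp: admissible_def)
  hence a0: "a \<noteq> 0" "a \<noteq> 1" by auto
  have i0: "i \<noteq> 0" using i by auto
  have diff: "a * inverse (x + s) - inverse x = w" if "x \<in> cross_half i s a h w" for x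
    using that by (simp add: cross_half_def)
  have gen: "w * ((x + s) * x) = a * x - (x + s)" "h \<longleftrightarrow> chi ((x + s) * x) = -1"
    if xs: "x \<in> cross_half i s a h w" "x \<noteq> 0" "x + s \<noteq> 0" for x
  proof -
    show "w * ((x + s) * x) = a * x - (x + s)"
      using scaled_inverse_diff_iff[OF xs(3,2), of a 1 w] diff[OF xs(1)] by simp
    have "i * (x + s) * (i * x) = i\<^sup>2 * ((x + s) * x)" by (simp add: power2_eq_square mult_ac)
    hence "chi (i * (x + s) * (i * x)) = chi ((x + s) * x)" unfolding i mult_1 by (rule arg_cong)
    moreover have "i * (x + s) \<noteq> 0" "i * x \<noteq> 0" using xs i0 by simp_all
    ultimately show "h \<longleftrightarrow> chi ((x + s) * x) = -1"
      using xs(1) chi_differ_iff[OF p2, of "i * (x + s)" "i * x"] by (simp add: cross_half_def del: mult_eq_0_iff)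
  qed
  have at_0: "y = 0" if "s \<noteq> 0" "0 \<in> cross_half i s a h w" "y \<in> cross_half i s a h w" for y
  proof (rule ccontr)
    assume y0: "y \<noteq> 0"
    have w: "w * s = a" using diff[OF that(2)] that(1) by auto
    show False
    proof (cases "y + s = 0")
      case True
      hence "y = - s" by (simp add: eq_neg_iff_add_eq_0)
      hence "w * s = 1" using diff[OF that(3)] that(1) by auto
      thus False using w a0 by simp
    next
      case False
      have "s * (w * ((y + s) * y)) = s * (a * y - (y + s))" using gen(1)[OF that(3) y0 False] by simp
      hence "a * (y * (y + s)) = s * (a * y - (y + s))" using w by (metis mult.assoc mult.commute)
      moreover have "a * (y * y) - (- (s * y) - s\<^sup>2) = a * (y * (y + s)) - s * (a * y - (y + s))"
        by (simp add: algebra_simps power2_eq_square)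
      ultimately have "a * (y * y) = - (s * y) - s\<^sup>2" by (metis right_minus_eq)
      moreover have "(a * y) * (a * y + s) = a * (a * (y * y)) + a * (s * y)" by (simp add: algebra_simps)
      ultimately have "(a * y) * (a * y + s) = a * (- (s * y) - s\<^sup>2) + a * (s * y)" by (simp only:)
      hence "(a * y) * (a * y + s) = - (a * s\<^sup>2)" by (simp add: right_diff_distrib)
      thus False using no_root_if_nonresidue[OF p2 a1(2) that(1)] by blast
    qed
  qed
  have at_s: "y = - s" if "s \<noteq> 0" "- s \<in> cross_half i s a h w" "y \<in> cross_half i s a h w" for y
  proof (rule ccontr)
    assume y0: "y \<noteq> - s"
    have w: "w * s = 1" using diff[OF that(2)] that(1) by auto
    have ys: "y + s \<noteq> 0" using y0 by (simp add: eq_neg_iff_add_eq_0)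
    show False
    proof (cases "y = 0")
      case True
      hence "w * s = a" using diff[OF that(3)] that(1) by auto
      thus False using w a0 by simp
    next
      case False
      have "s * (w * ((y + s) * y)) = s * (a * y - (y + s))" using gen(1)[OF that(3) False ys] by simp
      hence "y * (y + s) = s * (a * y - (y + s))" using w by (metis mult.assoc mult.commute mult_1)
      moreover have "(y + s)\<^sup>2 - a * (s * y) = y * (y + s) - s * (a * y - (y + s))"
        by (simp add: algebra_simps power2_eq_square)
      ultimately have eq: "(y + s)\<^sup>2 = a * (s * y)" by (metis right_minus_eq)
      (* With v = (y + s) / a the equation becomes v (v - s) = - s^2 / a. *)
      define v where "v = inverse a * (y + s)"
      have v: "y + s = a * v" using a0 by (simp add: v_def)
      hence y: "y = a * v - s" by (simp add: algebra_simps)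
      have "(a * v)\<^sup>2 = a * (s * (a * v - s))" using eq unfolding v y by simp
      hence "a * (a * (v * v)) = a * (a * (s * v) - s\<^sup>2)" by (simp add: power2_eq_square algebra_simps)
      hence "a * (v * v) = a * (s * v) - s\<^sup>2" using a0 by (metis mult_left_cancel)
      hence "inverse a * (a * (v * v)) = inverse a * (a * (s * v) - s\<^sup>2)" by simp
      hence "v * v = s * v - inverse a * s\<^sup>2" using a0 by (simp add: right_diff_distrib mult.assoc[symmetric])
      moreover have "v * (v + (- s)) = v * v - s * v" by (simp add: algebra_simps)
      ultimately have "v * (v + (- s)) = - (inverse a * (- s)\<^sup>2)" by simp
      thus False using no_root_if_nonresidue[OF p2 a1(3), of "- s"] that(1) by simp
    qed
  qed
  show ?thesis
  proof (cases "s = 0")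
    case True
    have *: "(a - 1) * inverse x = w" if "x \<in> cross_half i s a h w" for x
      using diff[OF that] True by (simp add: left_diff_distrib)
    have "(a - 1) * inverse x = (a - 1) * inverse y" using *[OF x] *[OF y] by simp
    thus ?thesis using a0 by simp
  next
    case s: False
    show ?thesis
    proof (cases "x \<in> {0, - s} \<or> y \<in> {0, - s}")
      case True
      thus ?thesis using at_0[OF s] at_s[OF s] x y by auto
    next
      case False
      hence nz: "x \<noteq> 0" "x + s \<noteq> 0" "y \<noteq> 0" "y + s \<noteq> 0" by (auto simp: eq_neg_iff_add_eq_0)
      note gx = gen[OF x nz(1,2)] and gy = gen[OF y nz(3,4)]
      show ?thesis
      proof (rule ccontr)
        assume xy: "x \<noteq> y"
        (* Vieta for the quadratic w X^2 + (w s + 1 - a) X + s, whose roots are x and y. *)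
        have "(x - y) * (w * (x + y + s)) = w * ((x + s) * x) - w * ((y + s) * y)"
          by (simp add: algebra_simps)
        also have "\<dots> = (x - y) * (a - 1)" unfolding gx(1) gy(1) by (simp add: algebra_simps)
        finally have sum: "w * (x + y + s) = a - 1" using xy by simp
        have "w * (x * y) = x * (w * (x + y + s)) - w * ((x + s) * x)" by (simp add: algebra_simps)
        also have "\<dots> = s" unfolding sum gx(1) by (simp add: algebra_simps)
        finally have prod: "w * (x * y) = s" .
        have "w * ((x + s) * (y + s)) = w * (x * y) + s * (w * (x + y + s))" by (simp add: algebra_simps)
        also have "\<dots> = a * s" unfolding sum prod by (simp add: algebra_simps)
        finally have prod': "w * ((x + s) * (y + s)) = a * s" .
        have w0: "w \<noteq> 0" using prod s by auto
        have "w\<^sup>2 * (((x + s) * x) * ((y + s) * y)) = (w * ((x + s) * (y + s))) * (w * (x * y))"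
          by (simp add: power2_eq_square mult_ac)
        also have "\<dots> = a * s\<^sup>2" unfolding prod prod' by (simp add: power2_eq_square mult_ac)
        finally have "chi (w\<^sup>2 * (((x + s) * x) * ((y + s) * y))) = chi (a * s\<^sup>2)" by simp
        hence "chi ((x + s) * x) * chi ((y + s) * y) = -1"
          unfolding chi_mult[OF p2] chi_square[OF w0] chi_square[OF s] a1 by simp
        thus False using gx(2) gy(2) chi_cases[of "(x + s) * x"] chi_cases[of "(y + s) * y"] by auto
      qed
    qed
  qed
qed

lemma solutions_card_le_2:
  fixes a c :: "'p::prime_card mod_ring"
  assumes p2: "2 < CARD('p)" and p3: "CARD('p) mod 3 = 2" and a: "admissible a" and u: "u \<noteq> (False, 0)"
  shows "card (solutions (field_map a c) u v) \<le> 2"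
proof -
  obtain e s h w where uv: "u = (e, s)" "v = (h, w)" by (cases u, cases v)
  show ?thesis
  proof (cases e)
    case False
    hence s: "s \<noteq> 0" using u uv by simp
    have "card (solutions (field_map a c) u v) \<le>
        card (Pair False ` same_half s False 1 h w) + card ((\<lambda>x. (True, x - c)) ` same_half s True a h w)"
      using False unfolding uv by (simp add: solutions_same_parity card_Un_le)
    also have "\<dots> \<le> card (same_half s False 1 h w) + card (same_half s True a h w)"
      by (intro add_mono card_image_le) auto
    also have "\<dots> \<le> 2" by (rule same_half_card_le_2[OF p2 p3 s a])
    finally show ?thesis .
  next
    case True
    have one: "card (cross_half i r a h w) \<le> 1" if "i\<^sup>2 = 1" for i r
      using cross_half_unique[OF p2 a that] by (simp add: card_le_Suc0_iff_eq)
    have "card (solutions (field_map a c) u v) \<le>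
        card (Pair False ` cross_half 1 (s + c) a h w \<union> (\<lambda>y. (True, - y - s)) ` cross_half (-1) (s - c) a h w)"
      using True solutions_opposite_parity[of a c s h w] unfolding uv by (simp add: card_mono)
    also have "\<dots> \<le> card (Pair False ` cross_half 1 (s + c) a h w) +
        card ((\<lambda>y. (True, - y - s)) ` cross_half (-1) (s - c) a h w)" by (rule card_Un_le)
    also have "\<dots> \<le> card (cross_half 1 (s + c) a h w) + card (cross_half (-1) (s - c) a h w)"
      by (intro add_mono card_image_le) auto
    also have "\<dots> \<le> 2" using one[of 1 "s + c"] one[of "-1" "s - c"] by simp
    finally show ?thesis .
  qed
qed

lemma same_half_generic:
  fixes s w :: "'p::prime_card mod_ring"
  assumes p2: "2 < CARD('p)" and x: "x \<noteq> 0" "x + s \<noteq> 0"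
    and "w * (x * (x + s)) = - (k * s)" "h \<longleftrightarrow> chi (x * (x + s)) = -1"
  shows "x \<in> same_half s e k h w"
  using scaled_inverse_diff_iff[OF x(2,1), of k k w] chi_differ_iff[OF p2 x] assms
  by (auto simp: same_half_def algebra_simps)

text \<open>
For every \<open>s\<close>, the reflection \<open>x \<mapsto> - s - x\<close> permutes the generic solutions of one parity. Here
\<open>s = 1\<close> and \<open>x = 1\<close>, whose partner -2 is different as \<open>p \<noteq> 3\<close>.
\<close>

lemma solutions_ge_2:
  fixes a c :: "'p::prime_card mod_ring"
  assumes p5: "5 < CARD('p)"
  shows "\<exists>v. 2 \<le> card (solutions (field_map a c) (False, 1) v)"
proof -
  note n = small_neq_0[OF p5]
  from p5 have p2: "2 < CARD('p)" by simp
  define h where "h \<longleftrightarrow> chi (2 :: 'p mod_ring) = -1"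
  define w where "w = - inverse (2 :: 'p mod_ring)"
  have w: "w * 2 = -1" using n by (simp add: w_def)
  have "1 \<in> same_half 1 False 1 h w" "-2 \<in> same_half 1 False 1 h w"
    using n w by (intro same_half_generic[OF p2]; simp add: h_def)+
  hence "{(False, 1), (False, -2)} \<subseteq> solutions (field_map a c) (False, 1) (h, w)"
    unfolding solutions_same_parity by blast
  hence "card {(False, 1), (False, -2 :: 'p mod_ring)} \<le> card (solutions (field_map a c) (False, 1) (h, w))"
    by (intro card_mono) auto
  moreover have "(1 :: 'p mod_ring) \<noteq> -2" using n by (simp add: eq_neg_iff_add_eq_0)
  ultimately have "2 \<le> card (solutions (field_map a c) (False, 1) (h, w))" by simp
  thus ?thesis by blast
qed

text \<open>
If \<open>1 - 4 a\<close> is a residue, the odd class has two generic solutions for \<open>w = 1 / s\<close>, and the even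
class has the exceptional solution 0. The character of \<open>s\<close> can be chosen such that all three
belong to the same bit \<open>h\<close>. If \<open>1 - 4 / a\<close> is a residue, the classes change their roles.
\<close>

lemma admissible_if_APN:
  fixes a c :: "'p::prime_card mod_ring"
  assumes p5: "5 < CARD('p)" and a0: "a \<noteq> 0" and inj: "inj (field_map a c)"
    and two: "\<And>u v. u \<noteq> (False, 0) \<Longrightarrow> card (solutions (field_map a c) u v) \<le> 2"
  shows "admissible a"
proof -
  from p5 have p2: "2 < CARD('p)" by simp
  have "chi a \<noteq> 1"
  proof
    assume "chi a = 1"
    hence "field_map a c (False, 1) = field_map a c (True, a - c)"
      using a0 by (simp add: field_map_def Let_def)
    from injD[OF inj this] show False by simp
  qed
  hence a1: "chi a = -1" using a0 chi_cases[of a] by auto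
  have three: False
    if "x \<in> same_half s e k h w" "- s - x \<in> same_half s e k h w" "0 \<in> same_half s (\<not> e) k' h w"
      "x \<noteq> - s - x" "s \<noteq> 0" "(e, k, k') \<in> {(True, a, 1), (False, 1, a)}" for x s e k h w k'
  proof -
    define S where "S = solutions (field_map a c) (False, s) (h, w)"
    define d where "d = (if e then c else 0)"
    define d' where "d' = (if e then 0 else c)"
    have "{(e, x - d), (e, - s - x - d), (\<not> e, - d')} \<subseteq> S"
      using that unfolding S_def solutions_same_parity d_def d'_def by (cases e) (auto simp: image_iff intro: bexI[of _ 0])
    hence "card {(e, x - d), (e, - s - x - d), (\<not> e, - d')} \<le> card S" by (intro card_mono) auto
    moreover have "card {(e, x - d), (e, - s - x - d), (\<not> e, - d')} = 3" using that(4) by simp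
    moreover have "card S \<le> 2" unfolding S_def using that(5) by (intro two) simp
    ultimately show False by simp
  qed
  (* a itself serves as the nonresidue. *)
  have sign: "\<exists>s :: 'p mod_ring. s \<noteq> 0 \<and> ((chi s = 1) \<longleftrightarrow> b)" for b
    using a1 a0 by (intro exI[of _ "if b then 1 else a"]) auto
  have roots: "x \<noteq> 0" "x + s \<noteq> 0" "- s - x \<noteq> 0" "- s - x + s \<noteq> 0"
      "(- s - x) * (- s - x + s) = x * (x + s)" "chi (x * (x + s)) = chi (- d)"
    if "x * (x + s) = - (d * s\<^sup>2)" "s \<noteq> 0" "d \<noteq> 0" for x s d :: "'p mod_ring"
  proof -
    have "x * (x + s) \<noteq> 0" using that by simp
    thus "x \<noteq> 0" "x + s \<noteq> 0" by auto
    thus "- s - x \<noteq> 0" "- s - x + s \<noteq> 0" by (auto simp: algebra_simps neg_eq_iff_add_eq_0)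
    show "(- s - x) * (- s - x + s) = x * (x + s)" by (simp add: algebra_simps)
    have "chi (x * (x + s)) = chi ((- d) * s\<^sup>2)" using that by simp
    also have "\<dots> = chi (- d)" unfolding chi_mult[OF p2] chi_square[OF that(2)] by simp
    finally show "chi (x * (x + s)) = chi (- d)" .
  qed
  have "chi (1 - 4 * a) \<noteq> 1"
  proof
    assume *: "chi (1 - 4 * a) = 1"
    define h where "h \<longleftrightarrow> chi (- a) = -1"
    obtain s :: "'p mod_ring" where s: "s \<noteq> 0" "(chi s = 1) \<longleftrightarrow> h" using sign by blast
    obtain x where x: "x * (x + s) = - (a * s\<^sup>2)" "x \<noteq> - s - x" using roots_if_residue[OF p5 * s(1)] .
    note r = roots[OF x(1) s(1) a0]
    define w where "w = inverse s"
    have ws: "w * s = 1" using s by (simp add: w_def)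
    have "w * (x * (x + s)) = - (a * (w * s) * s)" unfolding x by (simp add: power2_eq_square mult_ac)
    hence wx: "w * (x * (x + s)) = - (a * s)" using ws by simp
    show False
    proof (rule three)
      show "x \<in> same_half s True a h w" "- s - x \<in> same_half s True a h w"
        using r wx by (intro same_half_generic[OF p2]; simp only: h_def simp_thms)+
      show "0 \<in> same_half s (\<not> True) 1 h w" using s by (simp add: same_half_def w_def)
    qed (use x s in auto)
  qed
  moreover have "chi (1 - 4 * inverse a) \<noteq> 1"
  proof
    assume *: "chi (1 - 4 * inverse a) = 1"
    define h where "h \<longleftrightarrow> chi (- inverse a) = -1"
    obtain s :: "'p mod_ring" where s: "s \<noteq> 0" "(chi s = 1) \<longleftrightarrow> \<not> h" using sign by blast
    have ia: "inverse a \<noteq> 0" using a0 by simp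
    obtain x where x: "x * (x + s) = - (inverse a * s\<^sup>2)" "x \<noteq> - s - x"
      using roots_if_residue[OF p5 * s(1)] .
    note r = roots[OF x(1) s(1) ia]
    define w where "w = a * inverse s"
    have ws: "w * s = a" using s by (simp add: w_def)
    have "w * (x * (x + s)) = - (inverse a * (w * s) * s)" unfolding x by (simp add: power2_eq_square mult_ac)
    hence wx: "w * (x * (x + s)) = - (1 * s)" using ws a0 by simp
    show False
    proof (rule three)
      show "x \<in> same_half s False 1 h w" "- s - x \<in> same_half s False 1 h w"
        using r wx by (intro same_half_generic[OF p2]; simp only: h_def simp_thms)+
      show "0 \<in> same_half s (\<not> False) a h w" using s by (simp add: same_half_def w_def)
    qed (use x s in auto)
  qed
  ultimately show ?thesis unfolding admissible_def
    using a1 chi_cases[of "1 - 4 * a"] chi_cases[of "1 - 4 * inverse a"]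
      chi_eq_1_if_1_minus_4_mult[OF p5, of a] chi_eq_1_if_1_minus_4_inverse[OF p5 a0] by auto
qed

lemma field_map_parameters_unique:
  assumes "a \<noteq> (0 :: 'a::field)" "a' \<noteq> 0" and eq: "field_map a c = field_map a' c'"
  shows "a = a' \<and> c = c'"
proof -
  have *: "a * inverse (x + c) = a' * inverse (x + c')" for x
    using fun_cong[OF eq, of "(True, x)"] by (simp add: field_map_def Let_def)
  have "inverse (- c + c') = 0" using *[of "- c"] assms(2) by simp
  hence "c = c'" by simp
  thus ?thesis using *[of "1 - c"] by simp
qed

section \<open>Transfer to the integers modulo twice a prime\<close>

lemma bij_betw_restrict_UNIV:
  assumes bij: "bij_betw f A UNIV" and iff: "\<And>x. x \<in> A \<Longrightarrow> P x \<longleftrightarrow> f x \<in> S"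
  shows "bij_betw f {x \<in> A. P x} S"
proof (rule bij_betw_imageI)
  show "inj_on f {x \<in> A. P x}" by (rule inj_on_subset[OF bij_betw_imp_inj_on[OF bij]]) auto
  show "f ` {x \<in> A. P x} = S"
  proof (intro equalityI subsetI)
    fix y assume y: "y \<in> S"
    obtain x where "x \<in> A" "f x = y" using bij unfolding bij_betw_def by (metis UNIV_I imageE)
    thus "y \<in> f ` {x \<in> A. P x}" using y iff by blast
  qed (use iff in auto)
qed

definition residue_pair :: "int \<Rightarrow> bool \<times> 'p::prime_card mod_ring" where
  "residue_pair z = (odd z, of_int z)"

lemma odd_CARD: "2 < CARD('p::prime_card) \<Longrightarrow> odd CARD('p)"
  using prime_card[where ?'a = 'p] prime_odd_nat by blast

lemma residue_pair_eq_iff: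
  assumes "2 < CARD('p::prime_card)"
  shows "residue_pair x = (residue_pair y :: bool \<times> 'p mod_ring) \<longleftrightarrow> [x = y] (mod int (2 * CARD('p)))"
proof -
  have "coprime 2 (int CARD('p))" using odd_CARD[OF assms] by simp
  hence "2 * int CARD('p) dvd d \<longleftrightarrow> 2 dvd d \<and> int CARD('p) dvd d" for d
    by (metis divides_mult dvd_mult_left dvd_mult_right)
  hence "[x = y] (mod int (2 * CARD('p))) \<longleftrightarrow> [x = y] (mod 2) \<and> [x = y] (mod int CARD('p))"
    unfolding cong_iff_dvd_diff by simp
  moreover have "[x = y] (mod 2) \<longleftrightarrow> odd x = odd y"
    unfolding cong_iff_dvd_diff by auto
  ultimately show ?thesis by (simp add: residue_pair_def of_int_mod_ring_eq_iff)
qed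

lemma residue_pair_mod:
  "2 < CARD('p::prime_card) \<Longrightarrow>
    residue_pair (x mod int (2 * CARD('p))) = (residue_pair x :: bool \<times> 'p mod_ring)"
  by (subst residue_pair_eq_iff) (simp_all add: cong_def)

lemma residue_pair_bij:
  assumes "2 < CARD('p::prime_card)"
  shows "bij_betw (residue_pair :: int \<Rightarrow> bool \<times> 'p mod_ring) (Zn (2 * CARD('p))) UNIV"
proof -
  let ?f = "residue_pair :: int \<Rightarrow> bool \<times> 'p mod_ring"
  have "inj_on ?f (Zn (2 * CARD('p)))"
    unfolding inj_on_def residue_pair_eq_iff[OF assms] by (auto simp: Zn_def cong_def)
  moreover from this have "?f ` Zn (2 * CARD('p)) = UNIV"
    by (intro card_subset_eq) (auto simp: card_image Zn_def simp flip: UNIV_Times_UNIV)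
  ultimately show ?thesis by (simp add: bij_betw_def)
qed

context
  fixes F :: "int \<Rightarrow> int" and G :: "bool \<times> 'p::prime_card mod_ring \<Rightarrow> bool \<times> 'p mod_ring"
  assumes p2: "2 < CARD('p)"
    and F: "F \<in> Zn (2 * CARD('p)) \<rightarrow> Zn (2 * CARD('p))"
    and G: "\<And>z. z \<in> Zn (2 * CARD('p)) \<Longrightarrow> residue_pair (F z) = G (residue_pair z)"
begin

lemma card_solutions_transfer:
  assumes "v \<in> Zn (2 * CARD('p))"
  shows "card {x \<in> Zn (2 * CARD('p)).
      (F ((x + u) mod int (2 * CARD('p))) - F x) mod int (2 * CARD('p)) = v}
    = card (solutions G (residue_pair u) (residue_pair v))"
proof (rule bij_betw_same_card)
  let ?n = "2 * CARD('p)" and ?r = "residue_pair :: int \<Rightarrow> bool \<times> 'p mod_ring"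
  have "(F ((x + u) mod int ?n) - F x) mod int ?n = v \<longleftrightarrow> ?r x \<in> solutions G (?r u) (?r v)"
    if x: "x \<in> Zn ?n" for x
  proof -
    have "(x + u) mod int ?n \<in> Zn ?n" by (simp add: Zn_def)
    from G[OF this] have Gu: "?r (F ((x + u) mod int ?n)) = G (odd x \<noteq> odd u, of_int x + of_int u)"
      unfolding residue_pair_mod[OF p2] by (simp add: residue_pair_def)
    have "(F ((x + u) mod int ?n) - F x) mod int ?n = v \<longleftrightarrow>
        [F ((x + u) mod int ?n) - F x = v] (mod int ?n)"
      using assms by (simp add: cong_def Zn_def)
    also have "\<dots> \<longleftrightarrow> ?r (F ((x + u) mod int ?n) - F x) = ?r v" by (simp only: residue_pair_eq_iff[OF p2])
    also have "\<dots> \<longleftrightarrow> (fst (?r (F ((x + u) mod int ?n))) \<noteq> fst (?r (F x))) = fst (?r v) \<and>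
        snd (?r (F ((x + u) mod int ?n))) - snd (?r (F x)) = snd (?r v)"
      by (auto simp: residue_pair_def)
    also have "\<dots> \<longleftrightarrow> ?r x \<in> solutions G (?r u) (?r v)"
      unfolding Gu G[OF x] by (simp only: solutions_def mem_Collect_eq residue_pair_def fst_conv snd_conv)
    finally show ?thesis .
  qed
  thus "bij_betw ?r {x \<in> Zn ?n. (F ((x + u) mod int ?n) - F x) mod int ?n = v}
      (solutions G (?r u) (?r v))"
    by (rule bij_betw_restrict_UNIV[OF residue_pair_bij[OF p2]])
qed

text \<open>
The maximum that defines \<open>diff_uniformity\<close> is 2 iff 2 is attained and never exceeded.
\<close>

lemma APN_permutation_transfer:
  "APN_permutation (2 * CARD('p)) F \<longleftrightarrow> inj G \<and>
     (\<forall>u v. u \<noteq> (False, 0) \<longrightarrow> card (solutions G u v) \<le> 2) \<and>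
     (\<exists>u v. u \<noteq> (False, 0) \<and> card (solutions G u v) = 2)"
proof -
  let ?n = "2 * CARD('p)" and ?r = "residue_pair :: int \<Rightarrow> bool \<times> 'p mod_ring"
  define S where "S = {card (solutions G u v) | u v. u \<noteq> (False, 0)}"
  have n0: "0 \<in> Zn ?n" by (simp add: Zn_def)
  have r0: "?r u = (False, 0) \<longleftrightarrow> u = 0" if "u \<in> Zn ?n" for u
    using bij_betw_imp_inj_on[OF residue_pair_bij[OF p2]] that n0
    by (metis inj_onD residue_pair_def even_zero of_int_0)
  have surj: "\<exists>x \<in> Zn ?n. ?r x = z" for z
    using residue_pair_bij[OF p2] unfolding bij_betw_def by (metis UNIV_I imageE)
  have "{card {x \<in> Zn ?n. (F ((x + u) mod int ?n) - F x) mod int ?n = v} | u v.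
      u \<in> Zn ?n \<and> u \<noteq> 0 \<and> v \<in> Zn ?n} =
    {card (solutions G (?r u) (?r v)) | u v. u \<in> Zn ?n \<and> u \<noteq> 0 \<and> v \<in> Zn ?n}"
    by (intro Collect_cong ex_cong1 rev_conj_cong refl) (simp only: card_solutions_transfer)
  also have "\<dots> = S"
  proof (intro equalityI subsetI)
    fix k assume "k \<in> S"
    then obtain u v where uv: "k = card (solutions G u v)" "u \<noteq> (False, 0)" by (auto simp: S_def)
    obtain x y where "x \<in> Zn ?n" "?r x = u" "y \<in> Zn ?n" "?r y = v" using surj by metis
    thus "k \<in> {card (solutions G (?r u) (?r v)) | u v. u \<in> Zn ?n \<and> u \<noteq> 0 \<and> v \<in> Zn ?n}"
      using uv r0 by blast
  next
    fix k assume "k \<in> {card (solutions G (?r u) (?r v)) | u v. u \<in> Zn ?n \<and> u \<noteq> 0 \<and> v \<in> Zn ?n}"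
    then obtain u v where "k = card (solutions G (?r u) (?r v))" "?r u \<noteq> (False, 0)" using r0 by blast
    thus "k \<in> S" unfolding S_def by blast
  qed
  finally have "diff_uniformity ?n F = Max S" by (simp add: diff_uniformity_def)
  moreover have "finite S" "S \<noteq> {}"
  proof -
    have "S \<subseteq> (\<lambda>(u, v). card (solutions G u v)) ` UNIV" by (auto simp: S_def)
    thus "finite S" by (rule finite_subset) simp
    have "card (solutions G (True, 0) (True, 0)) \<in> S" unfolding S_def by blast
    thus "S \<noteq> {}" by blast
  qed
  ultimately have "diff_uniformity ?n F = 2 \<longleftrightarrow> 2 \<in> S \<and> (\<forall>k \<in> S. k \<le> 2)"
    by (simp add: Max_eq_iff)
  also have "\<dots> \<longleftrightarrow> (\<forall>u v. u \<noteq> (False, 0) \<longrightarrow> card (solutions G u v) \<le> 2) \<and>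
     (\<exists>u v. u \<noteq> (False, 0) \<and> card (solutions G u v) = 2)"
  proof -
    have "2 \<in> S \<longleftrightarrow> (\<exists>u v. u \<noteq> (False, 0) \<and> card (solutions G u v) = 2)"
      unfolding S_def mem_Collect_eq by metis
    moreover have "(\<forall>k \<in> S. k \<le> 2) \<longleftrightarrow> (\<forall>u v. u \<noteq> (False, 0) \<longrightarrow> card (solutions G u v) \<le> 2)"
      unfolding S_def by blast
    ultimately show ?thesis by blast
  qed
  finally have du: "diff_uniformity ?n F = 2 \<longleftrightarrow> \<dots>" .
  have "bij_betw F (Zn ?n) (Zn ?n) \<longleftrightarrow> inj_on F (Zn ?n)"
  proof
    assume *: "inj_on F (Zn ?n)"
    moreover have "F ` Zn ?n \<subseteq> Zn ?n" using F by blast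
    moreover have "finite (Zn ?n)" by (simp add: Zn_def)
    ultimately show "bij_betw F (Zn ?n) (Zn ?n)" by (simp add: bij_betw_def endo_inj_surj)
  qed (simp add: bij_betw_def)
  also have "\<dots> \<longleftrightarrow> inj G"
  proof
    assume *: "inj_on F (Zn ?n)"
    show "inj G"
    proof (rule injI)
      fix z z' assume eq: "G z = G z'"
      obtain x y where xy: "x \<in> Zn ?n" "?r x = z" "y \<in> Zn ?n" "?r y = z'" using surj by metis
      hence "?r (F x) = ?r (F y)" using eq G by simp
      hence "F x = F y" using F xy inj_onD[OF bij_betw_imp_inj_on[OF residue_pair_bij[OF p2]]] by blast
      thus "z = z'" using * xy by (auto dest: inj_onD)
    qed
  next
    assume *: "inj G"
    show "inj_on F (Zn ?n)"
    proof (rule inj_onI)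
      fix x y assume xy: "x \<in> Zn ?n" "y \<in> Zn ?n" "F x = F y"
      hence "G (?r x) = G (?r y)" using G by metis
      hence "?r x = ?r y" using * by (auto dest: injD)
      thus "x = y" using xy inj_onD[OF bij_betw_imp_inj_on[OF residue_pair_bij[OF p2]]] by blast
    qed
  qed
  finally show ?thesis unfolding APN_permutation_def APN_def using du F by blast
qed

end

text \<open>
This includes the convention that the inverse of 0 is 0.
\<close>

lemma inverse_eq_power:
  assumes "2 < CARD('p::prime_card)"
  shows "inverse (x :: 'p mod_ring) = x ^ (CARD('p) - 2)"
proof (cases "x = 0")
  case False
  have "CARD('p) = CARD('p) - 2 + 2" using assms by simp
  hence "x ^ (CARD('p) - 2) * x\<^sup>2 = x ^ CARD('p mod_ring)" by (metis CARD_mod_ring power_add)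
  also have "\<dots> = x" by (rule finite_field_power_card_eq_same)
  finally have "x * (x ^ (CARD('p) - 2) * x) = x * 1" by (simp add: power2_eq_square mult_ac)
  hence "x * x ^ (CARD('p) - 2) = 1" using False by (simp add: mult.commute)
  thus ?thesis by (rule inverse_unique)
qed (use assms in simp)

lemma of_int_CARD: "of_int (int CARD('p::prime_card)) = (0 :: 'p mod_ring)"
  by (simp add: of_nat_eq_0_iff_char_dvd CHAR_mod_ring)

lemma of_int_mod_CARD: "of_int (x mod int CARD('p)) = (of_int x :: 'p::prime_card mod_ring)"
  unfolding of_int_mod_ring_eq_iff by (simp add: cong_def)

lemma residue_pair_B_map:
  assumes p2: "2 < CARD('p::prime_card)" and z: "z \<in> Zn (2 * CARD('p))"
  shows "residue_pair (B_map CARD('p) a c z) = field_map (of_int a :: 'p mod_ring) (of_int c) (residue_pair z)"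
proof -
  let ?p = "CARD('p)"
  define y :: "'p mod_ring" where "y = of_int z + (if odd z then of_int c else 0)"
  have parity: "parity z = (if odd z then 1 else 0)" unfolding parity_def by presburger
  have X: "of_int (X_res ?p c z) = y"
    unfolding X_res_def of_int_mod_CARD y_def parity by simp
  have A: "of_int (A_coeff ?p a z) = (if odd z then of_int a else 1 :: 'p mod_ring)"
    unfolding A_coeff_def of_int_mod_CARD parity by simp
  have Y: "of_int (Y_res ?p a c z) = (if odd z then of_int a else 1) * inverse y"
    unfolding Y_res_def of_int_mod_CARD inverse_eq_power[OF p2] by (simp add: A X)
  have L: "Legendre (X_res ?p c z) (int ?p) = chi y"
    unfolding chi_of_int[where ?'p = 'p, symmetric] X ..
  have R: "odd (R_bit ?p c z) \<longleftrightarrow> residue_bit (odd z) y"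
    unfolding R_bit_def rho_def L parity residue_bit_def using chi_cases[of y] by auto
  have "residue_pair (B_map ?p a c z)
      = (residue_pair (int ?p * R_bit ?p c z + (int ?p + 1) * Y_res ?p a c z) :: bool \<times> 'p mod_ring)"
    unfolding B_map_def using z by (simp add: residue_pair_mod[OF p2] del: of_nat_mult)
  also have "\<dots> = (odd (R_bit ?p c z), of_int (Y_res ?p a c z))"
    using odd_CARD[OF p2] of_int_CARD[where ?'p = 'p] by (simp add: residue_pair_def)
  also have "\<dots> = field_map (of_int a) (of_int c) (residue_pair z)"
    unfolding R Y by (simp add: residue_pair_def field_map_def Let_def y_def)
  finally show ?thesis .
qed

lemma APN_permutation_B_map_iff:
  assumes p5: "5 < CARD('p::prime_card)" and p3: "CARD('p) mod 3 = 2"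
    and a: "(of_int a :: 'p mod_ring) \<noteq> 0"
  shows "APN_permutation (2 * CARD('p)) (B_map CARD('p) a c) \<longleftrightarrow> admissible (of_int a :: 'p mod_ring)"
proof -
  let ?G = "field_map (of_int a :: 'p mod_ring) (of_int c)"
  from p5 have p2: "2 < CARD('p)" by simp
  have "B_map CARD('p) a c \<in> Zn (2 * CARD('p)) \<rightarrow> Zn (2 * CARD('p))"
    by (auto simp: B_map_def Zn_def)
  hence *: "APN_permutation (2 * CARD('p)) (B_map CARD('p) a c) \<longleftrightarrow> inj ?G \<and>
     (\<forall>u v. u \<noteq> (False, 0) \<longrightarrow> card (solutions ?G u v) \<le> 2) \<and>
     (\<exists>u v. u \<noteq> (False, 0) \<and> card (solutions ?G u v) = 2)"
    by (rule APN_permutation_transfer[OF p2]) (rule residue_pair_B_map[OF p2])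
  show ?thesis
  proof
    assume "admissible (of_int a :: 'p mod_ring)"
    hence inj: "inj ?G" and le: "\<forall>u v. u \<noteq> (False, 0) \<longrightarrow> card (solutions ?G u v) \<le> 2"
      using field_map_inj[OF p2] solutions_card_le_2[OF p2 p3] by (auto simp: admissible_def)
    obtain v where "2 \<le> card (solutions ?G (False, 1) v)" using solutions_ge_2[OF p5] by blast
    moreover have "(False, 1 :: 'p mod_ring) \<noteq> (False, 0)" by simp
    ultimately have ex: "\<exists>u v. u \<noteq> (False, 0) \<and> card (solutions ?G u v) = 2"
      using le le_antisym by blast
    show "APN_permutation (2 * CARD('p)) (B_map CARD('p) a c)"
      by (rule iffD2[OF *]) (intro conjI inj le ex)
  next
    assume "APN_permutation (2 * CARD('p)) (B_map CARD('p) a c)"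
    hence G: "inj ?G" "\<forall>u v. u \<noteq> (False, 0) \<longrightarrow> card (solutions ?G u v) \<le> 2"
      using iffD1[OF *] by simp_all
    show "admissible (of_int a :: 'p mod_ring)"
      by (rule admissible_if_APN[OF p5 a G(1)]) (use G(2) in blast)
  qed
qed

lemma units_mod_iff:
  "a \<in> units_mod CARD('p::prime_card) \<longleftrightarrow> a \<in> Zn CARD('p) \<and> (of_int a :: 'p mod_ring) \<noteq> 0"
proof -
  have "coprime a (int CARD('p)) \<longleftrightarrow> \<not> int CARD('p) dvd a"
    using prime_card_int[where ?'a = 'p] by (metis coprime_commute prime_imp_coprime coprime_absorb_left not_prime_unit)
  thus ?thesis using of_int_mod_ring_eq_iff[of a 0, where ?'p = 'p]
    by (simp add: units_mod_def cong_0_iff)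
qed

lemma A_set_iff:
  "a \<in> A_set CARD('p::prime_card) \<longleftrightarrow> a \<in> Zn CARD('p) \<and> admissible (of_int a :: 'p mod_ring)"
proof (cases "a \<in> Zn CARD('p) \<and> (of_int a :: 'p mod_ring) \<noteq> 0")
  case True
  hence cop: "coprime (int CARD('p)) a" using units_mod_iff[of a, where ?'p = 'p]
    by (simp add: units_mod_def coprime_commute)
  have "of_int (a * modular_inverse (int CARD('p)) a) = (of_int 1 :: 'p mod_ring)"
    unfolding of_int_mod_ring_eq_iff using cong_modular_inverse1[of a "int CARD('p)"] cop by (simp add: coprime_commute)
  hence "inverse (of_int a :: 'p mod_ring) = of_int (modular_inverse (int CARD('p)) a)"
    by (intro inverse_unique) simp
  thus ?thesis using True units_mod_iff[of a, where ?'p = 'p]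
    by (simp add: A_set_def admissible_def chi_of_int[where ?'p = 'p, symmetric])
next
  case False
  thus ?thesis using units_mod_iff[of a, where ?'p = 'p] by (auto simp: A_set_def admissible_def)
qed

lemma Zn_bij: "bij_betw (of_int :: int \<Rightarrow> 'p::prime_card mod_ring) (Zn CARD('p)) UNIV"
  unfolding Zn_def by (rule of_int_mod_ring_bij)

lemma card_A_set:
  "card (A_set CARD('p::prime_card)) = card {a :: 'p mod_ring. admissible a}"
proof (rule bij_betw_same_card)
  have "A_set CARD('p) = {a \<in> Zn CARD('p). admissible (of_int a :: 'p mod_ring)}"
    using A_set_iff[where ?'p = 'p] by blast
  thus "bij_betw of_int (A_set CARD('p)) {a :: 'p mod_ring. admissible a}"
    using bij_betw_restrict_UNIV[OF Zn_bij[where ?'p = 'p], of "\<lambda>a. admissible (of_int a :: 'p mod_ring)" "Collect admissible"]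
    by simp
qed

lemma T_sum_eq:
  "T_sum CARD('p::prime_card) = (\<Sum>z\<in>UNIV. chi (z * (z - 4) * (1 - 4 * z) :: 'p mod_ring))"
proof -
  have "T_sum CARD('p) = (\<Sum>z\<in>Zn CARD('p). chi (of_int (z * (z - 4) * (1 - 4 * z)) :: 'p mod_ring))"
    by (simp only: T_sum_def chi_of_int)
  also have "\<dots> = (\<Sum>z\<in>Zn CARD('p). (\<lambda>x. chi (x * (x - 4) * (1 - 4 * x))) (of_int z :: 'p mod_ring))"
    by simp
  also have "\<dots> = (\<Sum>z\<in>UNIV. chi (z * (z - 4) * (1 - 4 * z) :: 'p mod_ring))"
    by (rule sum.reindex_bij_betw[OF Zn_bij])
  finally show ?thesis .
qed

lemma A_set_nonzero:
  "a \<in> A_set CARD('p::prime_card) \<Longrightarrow> (of_int a :: 'p mod_ring) \<noteq> 0"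
  unfolding A_set_iff[where ?'p = 'p] by (auto simp: admissible_def)

lemma card_APN_family:
  assumes p5: "5 < CARD('p::prime_card)" and p3: "CARD('p) mod 3 = 2"
  shows "card {F \<in> B_family CARD('p). APN_permutation (2 * CARD('p)) F} = CARD('p) * card (A_set CARD('p))"
proof -
  let ?p = "CARD('p)"
  from p5 have p2: "2 < CARD('p)" by simp
  note nz = A_set_nonzero[where ?'p = 'p]
  have iff: "a \<in> units_mod ?p \<and> APN_permutation (2 * ?p) (B_map ?p a c) \<longleftrightarrow> a \<in> A_set ?p" for a c
    using APN_permutation_B_map_iff[OF p5 p3, of a c] units_mod_iff[of a, where ?'p = 'p]
      A_set_iff[of a, where ?'p = 'p] nz[of a] by auto
  have "{F \<in> B_family ?p. APN_permutation (2 * ?p) F} =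
      {B_map ?p a c | a c. (a \<in> units_mod ?p \<and> APN_permutation (2 * ?p) (B_map ?p a c)) \<and> c \<in> Zn ?p}"
    unfolding B_family_def by blast
  also have "\<dots> = (\<lambda>(a, c). B_map ?p a c) ` (A_set ?p \<times> Zn ?p)"
    unfolding iff by auto
  finally have "{F \<in> B_family ?p. APN_permutation (2 * ?p) F} = (\<lambda>(a, c). B_map ?p a c) ` (A_set ?p \<times> Zn ?p)" .
  moreover have "inj_on (\<lambda>(a, c). B_map ?p a c) (A_set ?p \<times> Zn ?p)"
  proof (rule inj_onI, clarify)
    fix a c a' c'
    assume *: "a \<in> A_set ?p" "c \<in> Zn ?p" "a' \<in> A_set ?p" "c' \<in> Zn ?p" "B_map ?p a c = B_map ?p a' c'"
    have "field_map (of_int a :: 'p mod_ring) (of_int c) = field_map (of_int a') (of_int c')"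
    proof
      fix z :: "bool \<times> 'p mod_ring"
      obtain x where x: "x \<in> Zn (2 * ?p)" "residue_pair x = z"
        using residue_pair_bij[OF p2] unfolding bij_betw_def by (metis UNIV_I imageE)
      show "field_map (of_int a) (of_int c) z = field_map (of_int a') (of_int c') z"
        using residue_pair_B_map[OF p2 x(1), of a c] residue_pair_B_map[OF p2 x(1), of a' c'] *(5) x(2) by simp
    qed
    from field_map_parameters_unique[OF nz[OF *(1)] nz[OF *(3)] this]
    have "(of_int a :: 'p mod_ring) = of_int a'" "(of_int c :: 'p mod_ring) = of_int c'" by simp_all
    thus "a = a' \<and> c = c'"
      using * A_set_iff[where ?'p = 'p] inj_onD[OF bij_betw_imp_inj_on[OF Zn_bij[where ?'p = 'p]]] by blast
  qed
  ultimately show ?thesis by (simp add: card_image card_cartesian_product Zn_def)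
qed

section \<open>From one prime to all primes\<close>

definition APN_count_statement :: "nat \<Rightarrow> bool" where
  "APN_count_statement p \<longleftrightarrow>
     (\<forall>a \<in> A_set p. \<forall>c \<in> Zn p. APN_permutation (2 * p) (B_map p a c)) \<and>
     card {F \<in> B_family p. APN_permutation (2 * p) F} = p * card (A_set p) \<and>
     real (p * card (A_set p)) = real p * (real p + 1 + of_int (T_sum p)) / 8 \<and>
     real (card {F \<in> B_family p. APN_permutation (2 * p) F})
       \<ge> real p * (real p + 1 - 2 * sqrt (real p)) / 8"

lemma APN_count_statement_CARD:
  assumes p5: "5 < CARD('p::prime_card)" and "[CARD('p) = 5] (mod 6)"
  shows "APN_count_statement CARD('p)"
proof -
  let ?p = "CARD('p)" and ?T = "real_of_int (T_sum CARD('p))"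
  have "?p mod 3 = ?p mod 6 mod 3" by (simp add: mod_mod_cancel)
  hence p3: "?p mod 3 = 2" using assms(2) by (simp add: cong_def)
  have "8 * int (card (A_set ?p)) = int ?p + 1 + T_sum ?p"
    using card_admissible[OF p5] by (simp add: card_A_set T_sum_eq)
  hence "real_of_int (8 * int (card (A_set ?p))) = real_of_int (int ?p + 1 + T_sum ?p)" by simp
  hence card: "8 * real (card (A_set ?p)) = real ?p + 1 + ?T" by simp
  have "(T_sum ?p)\<^sup>2 \<le> 4 * int ?p"
    using sum_chi_curve_bound[OF p5] by (simp add: T_sum_eq)
  hence "real_of_int ((T_sum ?p)\<^sup>2) \<le> real_of_int (4 * int ?p)" by (simp only: of_int_le_iff)
  hence "?T\<^sup>2 \<le> (2 * sqrt (real ?p))\<^sup>2" by (simp add: power_mult_distrib)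
  hence "\<bar>?T\<bar> \<le> \<bar>2 * sqrt (real ?p)\<bar>" by (simp only: abs_le_square_iff)
  hence T: "- (2 * sqrt (real ?p)) \<le> ?T" by simp
  have eq: "real (?p * card (A_set ?p)) = real ?p * (real ?p + 1 + ?T) / 8"
    using card by simp
  have "real ?p * (real ?p + 1 - 2 * sqrt (real ?p)) \<le> real ?p * (real ?p + 1 + ?T)"
    using T by (intro mult_left_mono) auto
  moreover have "APN_permutation (2 * ?p) (B_map ?p a c)" if "a \<in> A_set ?p" for a c
    using that APN_permutation_B_map_iff[OF p5 p3, of a c] A_set_iff[of a, where ?'p = 'p]
      A_set_nonzero[of a, where ?'p = 'p] by auto
  ultimately show ?thesis
    unfolding APN_count_statement_def card_APN_family[OF p5 p3] eq by auto
qed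

text \<open>
A prime that obeys the theorem only if all primes do; it exists by the drinker's paradox: take
a counterexample if there is one, and any prime otherwise. As a closed term it may serve as
the cardinality of a type, so that the results about \<open>'p mod_ring\<close> apply to it.
\<close>

definition decisive_prime :: nat where
  "decisive_prime = (SOME p. prime p \<and>
     ((p > 5 \<and> [p = 5] (mod 6) \<longrightarrow> APN_count_statement p) \<longrightarrow>
       (\<forall>q. prime q \<and> q > 5 \<and> [q = 5] (mod 6) \<longrightarrow> APN_count_statement q)))"

lemma decisive_prime:
  "prime decisive_prime"
  "\<lbrakk>decisive_prime > 5 \<Longrightarrow> [decisive_prime = 5] (mod 6) \<Longrightarrow> APN_count_statement decisive_prime;
    prime q; q > 5; [q = 5] (mod 6)\<rbrakk> \<Longrightarrow> APN_count_statement q"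
proof -
  have "\<exists>p. prime p \<and>
     ((p > 5 \<and> [p = 5] (mod 6) \<longrightarrow> APN_count_statement p) \<longrightarrow>
       (\<forall>q. prime q \<and> q > 5 \<and> [q = 5] (mod 6) \<longrightarrow> APN_count_statement q))"
    using two_is_prime_nat by blast
  from someI_ex[OF this, folded decisive_prime_def]
  show "prime decisive_prime"
    "\<lbrakk>decisive_prime > 5 \<Longrightarrow> [decisive_prime = 5] (mod 6) \<Longrightarrow> APN_count_statement decisive_prime;
      prime q; q > 5; [q = 5] (mod 6)\<rbrakk> \<Longrightarrow> APN_count_statement q"
    by blast+
qed

typedef decisive_index = "{..<decisive_prime}"
  using prime_gt_0_nat[OF decisive_prime(1)] by auto

lemma CARD_decisive_index: "CARD(decisive_index) = decisive_prime"
  using type_definition.card[OF type_definition_decisive_index] by simp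

lemma prime_CARD_decisive_index: "prime CARD(decisive_index)"
  unfolding CARD_decisive_index by (rule decisive_prime(1))

instance decisive_index :: prime_card
proof
  show "prime CARD(decisive_index)" by (rule prime_CARD_decisive_index)
qed

theorem corollary2:
  fixes p :: nat
  assumes "prime p" and "p > 5" and "[p = 5] (mod 6)"
  shows "(\<forall>a \<in> A_set p. \<forall>c \<in> Zn p. APN_permutation (2 * p) (B_map p a c)) \<and>
         card {F \<in> B_family p. APN_permutation (2 * p) F} = p * card (A_set p) \<and>
         real (p * card (A_set p)) = real p * (real p + 1 + of_int (T_sum p)) / 8 \<and>
         real (card {F \<in> B_family p. APN_permutation (2 * p) F})
           \<ge> real p * (real p + 1 - 2 * sqrt (real p)) / 8"
proof -
  have "APN_count_statement p"
  proof (rule decisive_prime(2))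
    show "APN_count_statement decisive_prime" if "decisive_prime > 5" "[decisive_prime = 5] (mod 6)"
      using APN_count_statement_CARD[where ?'p = decisive_index] that by (simp only: CARD_decisive_index)
  qed (fact assms)+
  thus ?thesis unfolding APN_count_statement_def .
qed

end
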